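(* $[\mathbf{Txt}\mathbf{Sd}\mathbf{Bc}_C]_{\mathbf{REC}} \setminus [\mathbf{Txt}\mathbf{G}\mathbf{Ex}_C]_{\mathbf{REC}} \neq \emptyset$.
   Context: Fix an acceptable numbering $(\varphi_e)_{e\in\mathbb{N}}$ of all partial computable functions. A number $e$ is a $C$-index if $\varphi_e$ is total with values in $\{0,1\}$; then $C_e=\{x:\varphi_e(x)=1\}$. $\mathbf{REC}$ is the collection of recursive subsets of $\mathbb{N}$; $\mathcal{P}$ denotes the partial computable functions. Fix a pause symbol $\#$. A text is a total function $T:\mathbb{N}\to\mathbb{N}\cup\{\#\}$, $\mathrm{content}(T)=\mathrm{range}(T)\setminus\{\#\}$, $T$ is a text for $L$ if $\mathrm{content}(T)=L$, $T[n]=(T(0),\dots,T(n-1))$. A learner is some $h\in\mathcal{P}$. Hypothesis sequences: $\mathbf{G}(h,T)(i)=h(T[i])$; $\mathbf{Sd}(h,T)(i)=h(\mathrm{content}(T[i]))$. Restrictions on hypothesis sequence $p$ and text $T$: $\mathbf{Ex}_C$: there is $n_0$ with $p(n)=p(n_0)$ for all $n\ge n_0$ and $p(n_0)$ a $C$-index with $C_{p(n_0)}=\mathrm{content}(T)$; $\mathbf{Bc}_C$: there is $n_0$ such that for all $n\ge n_0$, $p(n)$ is a $C$-index with $C_{p(n)}=\mathrm{content}(T)$. A learner $h$ $\mathbf{Txt}\beta\delta$-learns $L$ iff $\delta(\beta(h,T),T)$ holds for every text $T$ for $L$; $[\mathbf{Txt}\beta\delta]_{\mathbf{REC}}$ is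 the set of all classes $\mathcal{L}\subseteq\mathbf{REC}$ for which some $h\in\mathcal{P}$ learns every $L\in\mathcal{L}$. *)

theory Defs
  imports "HOL-Library.Nat_Bijection"
begin

section \<open>Partial computable functions\<close>

text \<open>
  Partial functions on tuples are modelled as functions on lists, with \<open>None\<close> for divergence.
  Arities are not tracked: a function is only used on lists of one fixed length, and on lists that
  are too short the basic functions diverge.  On tuples of any fixed length the functions below are
  therefore exactly the partial recursive functions of that arity.
\<close>

definition zero_fn :: "nat list \<Rightarrow> nat option" where
  "zero_fn xs = Some 0"

definition succ_fn :: "nat list \<Rightarrow> nat option" where
  "succ_fn xs = (case xs of [] \<Rightarrow> None | x # _ \<Rightarrow> Some (Suc x))"

definition proj_fn :: "nat \<Rightarrow> nat list \<Rightarrow> nat option" where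
  "proj_fn i xs = (if i < length xs then Some (xs ! i) else None)"

definition comp_fn ::
    "(nat list \<Rightarrow> nat option) \<Rightarrow> (nat list \<Rightarrow> nat option) list \<Rightarrow> nat list \<Rightarrow> nat option" where
  "comp_fn f gs xs =
     (if \<forall>g\<in>set gs. g xs \<noteq> None then f (map (\<lambda>g. the (g xs)) gs) else None)"

primrec iter_fn ::
    "(nat list \<Rightarrow> nat option) \<Rightarrow> (nat list \<Rightarrow> nat option) \<Rightarrow> nat \<Rightarrow> nat list \<Rightarrow> nat option" where
  "iter_fn f g 0 ys = f ys"
| "iter_fn f g (Suc n) ys = Option.bind (iter_fn f g n ys) (\<lambda>r. g (n # r # ys))"

definition primrec_fn ::
    "(nat list \<Rightarrow> nat option) \<Rightarrow> (nat list \<Rightarrow> nat option) \<Rightarrow> nat list \<Rightarrow> nat option" where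
  "primrec_fn f g xs = (case xs of [] \<Rightarrow> None | n # ys \<Rightarrow> iter_fn f g n ys)"

text \<open>Unbounded search diverges when \<open>f\<close> diverges on an argument below the first zero.\<close>

definition first_zero :: "(nat list \<Rightarrow> nat option) \<Rightarrow> nat list \<Rightarrow> nat \<Rightarrow> bool" where
  "first_zero f xs n \<longleftrightarrow> f (n # xs) = Some 0 \<and> (\<forall>m<n. \<exists>k. f (m # xs) = Some (Suc k))"

definition mu_fn :: "(nat list \<Rightarrow> nat option) \<Rightarrow> nat list \<Rightarrow> nat option" where
  "mu_fn f xs = (if \<exists>n. first_zero f xs n then Some (THE n. first_zero f xs n) else None)"

inductive partial_recursive :: "(nat list \<Rightarrow> nat option) \<Rightarrow> bool" where
  zero: "partial_recursive zero_fn"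
| succ: "partial_recursive succ_fn"
| proj: "partial_recursive (proj_fn i)"
| comp: "\<lbrakk>partial_recursive f; \<And>g. g \<in> set gs \<Longrightarrow> partial_recursive g\<rbrakk>
    \<Longrightarrow> partial_recursive (comp_fn f gs)"
| prec: "\<lbrakk>partial_recursive f; partial_recursive g\<rbrakk> \<Longrightarrow> partial_recursive (primrec_fn f g)"
| mu: "partial_recursive f \<Longrightarrow> partial_recursive (mu_fn f)"

definition partial_computable :: "(nat \<Rightarrow> nat option) \<Rightarrow> bool" where
  "partial_computable f \<longleftrightarrow> (\<exists>g. partial_recursive g \<and> (\<forall>x. g [x] = f x))"

definition partial_computable2 :: "(nat \<Rightarrow> nat \<Rightarrow> nat option) \<Rightarrow> bool" where
  "partial_computable2 f \<longleftrightarrow> (\<exists>g. partial_recursive g \<and> (\<forall>x y. g [x, y] = f x y))"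

definition total_computable :: "(nat \<Rightarrow> nat) \<Rightarrow> bool" where
  "total_computable f \<longleftrightarrow> partial_computable (\<lambda>x. Some (f x))"

text \<open>
  Acceptability in the sense of Rogers: the numbering is itself computable (it has a universal
  function), and every computable numbering \<open>\<psi>\<close> translates into it effectively.  Since \<open>\<psi>\<close> may
  ignore its first argument, an acceptable numbering lists all unary partial computable functions.
\<close>

definition acceptable_numbering :: "(nat \<Rightarrow> nat \<Rightarrow> nat option) \<Rightarrow> bool" where
  "acceptable_numbering \<phi> \<longleftrightarrow>
     partial_computable2 \<phi> \<and>
     (\<forall>\<psi>. partial_computable2 \<psi> \<longrightarrow> (\<exists>t. total_computable t \<and> (\<forall>e. \<phi> (t e) = \<psi> e)))"

definition REC :: "nat set set" where
  "REC = {A. total_computable (\<lambda>x. if x \<in> A then 1 else 0)}"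

definition C_index :: "(nat \<Rightarrow> nat \<Rightarrow> nat option) \<Rightarrow> nat \<Rightarrow> bool" where
  "C_index \<phi> e \<longleftrightarrow> (\<forall>x. \<phi> e x = Some 0 \<or> \<phi> e x = Some 1)"

definition C_set :: "(nat \<Rightarrow> nat \<Rightarrow> nat option) \<Rightarrow> nat \<Rightarrow> nat set" where
  "C_set \<phi> e = {x. \<phi> e x = Some 1}"


section \<open>Texts and learning\<close>

text \<open>The pause symbol is \<open>None\<close>.\<close>

type_synonym text_fn = "nat \<Rightarrow> nat option"

definition content :: "text_fn \<Rightarrow> nat set" where
  "content T = {x. Some x \<in> range T}"

definition text_for :: "text_fn \<Rightarrow> nat set \<Rightarrow> bool" where
  "text_for T L \<longleftrightarrow> content T = L"

definition text_prefix :: "text_fn \<Rightarrow> nat \<Rightarrow> nat option list" where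
  "text_prefix T n = map T [0..<n]"

definition list_content :: "nat option list \<Rightarrow> nat set" where
  "list_content xs = {x. Some x \<in> set xs}"

text \<open>
  Learners are partial computable functions on numbers, so their inputs (finite sequences over
  \<open>\<nat> \<union> {#}\<close>, and finite sets) are passed through the computable bijections
  \<^const>\<open>list_encode\<close> and \<^const>\<open>set_encode\<close>; the pause symbol is coded as 0 and \<open>n\<close> as \<open>Suc n\<close>.
\<close>

definition seq_code :: "nat option list \<Rightarrow> nat" where
  "seq_code xs = list_encode (map (case_option 0 Suc) xs)"

type_synonym learner = "nat \<Rightarrow> nat option"

text \<open>As learners may be partial, so may be hypothesis sequences.\<close>

type_synonym hyp_seq = "nat \<Rightarrow> nat option"

definition G :: "learner \<Rightarrow> text_fn \<Rightarrow> hyp_seq" where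
  "G h T i = h (seq_code (text_prefix T i))"

definition Sd :: "learner \<Rightarrow> text_fn \<Rightarrow> hyp_seq" where
  "Sd h T i = h (set_encode (list_content (text_prefix T i)))"

definition Ex_C :: "(nat \<Rightarrow> nat \<Rightarrow> nat option) \<Rightarrow> hyp_seq \<Rightarrow> text_fn \<Rightarrow> bool" where
  "Ex_C \<phi> p T \<longleftrightarrow>
     (\<exists>n0. (\<forall>n\<ge>n0. p n = p n0) \<and>
           (\<exists>e. p n0 = Some e \<and> C_index \<phi> e \<and> C_set \<phi> e = content T))"

definition Bc_C :: "(nat \<Rightarrow> nat \<Rightarrow> nat option) \<Rightarrow> hyp_seq \<Rightarrow> text_fn \<Rightarrow> bool" where
  "Bc_C \<phi> p T \<longleftrightarrow>
     (\<exists>n0. \<forall>n\<ge>n0. \<exists>e. p n = Some e \<and> C_index \<phi> e \<and> C_set \<phi> e = content T)"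

definition Txt_learns ::
    "(learner \<Rightarrow> text_fn \<Rightarrow> hyp_seq) \<Rightarrow> (hyp_seq \<Rightarrow> text_fn \<Rightarrow> bool) \<Rightarrow> learner \<Rightarrow> nat set \<Rightarrow> bool" where
  "Txt_learns \<beta> \<delta> h L \<longleftrightarrow> (\<forall>T. text_for T L \<longrightarrow> \<delta> (\<beta> h T) T)"

definition Txt_REC ::
    "(learner \<Rightarrow> text_fn \<Rightarrow> hyp_seq) \<Rightarrow> (hyp_seq \<Rightarrow> text_fn \<Rightarrow> bool) \<Rightarrow> nat set set set" where
  "Txt_REC \<beta> \<delta> =
     {\<L>. \<L> \<subseteq> REC \<and> (\<exists>h. partial_computable h \<and> (\<forall>L\<in>\<L>. Txt_learns \<beta> \<delta> h L))}"

end

theory Submission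
  imports Defs
begin

text \<open>
  Let every number \<open>x\<close> carry the code \<open>p1 x\<close> of a program, and let \<open>t x\<close> be an index of
  \<open>\<lambda>y. \<phi> (p1 x) \<langle>x, y\<rangle>\<close>; running a program on a number that contains its own code replaces
  the recursion theorem.  The separating class consists of the infinite recursive sets \<open>L\<close> such
  that \<open>t x\<close> is a \<open>C\<close>-index of \<open>L\<close> for all but finitely many \<open>x \<in> L\<close>.  The learner
  \<open>D \<mapsto> t (Max D)\<close> is set-driven and behaviourally correct on this class.

  Given a learner \<open>h\<close>, grow a text in stages.  A stage consists of a history \<open>\<rho>\<close> and a
  hypothesis \<open>v\<close>.  It offers, for each \<open>b\<close>, the continuation of \<open>\<rho>\<close> by
  \<open>\<langle>e, \<langle>\<rho>, v, b\<rangle>, k\<rangle>\<close> for \<open>k = 0, 1, \<dots>\<close>, and searches for a \<open>b\<close> and a prefix of that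
  continuation on which \<open>h\<close> outputs something other than \<open>v\<close>; the next stage extends this prefix.
  If some stage never ends, then for every \<open>b\<close> the history together with the whole branch \<open>b\<close>
  is in the class, and \<open>h\<close> can only converge to \<open>v\<close> on each of these different sets.  If all
  stages end, the union of the histories is in the class and \<open>h\<close> changes its mind infinitely often
  on the text.  The branches not chosen by a stage are discarded altogether, so their programs never
  have to be correct, whereas the program of a chosen branch can decide the limit set.
\<close>

section \<open>Closure properties of computable functions\<close>

text \<open>Agreement is required only on lists of length \<open>n\<close>, since arities are
  modelled by list lengths and the values on other lists are artefacts of the basic
  functions.\<close>

definition prec_on :: "nat \<Rightarrow> (nat list \<Rightarrow> nat option) \<Rightarrow> bool" where
  "prec_on n f \<longleftrightarrow> (\<exists>g. partial_recursive g \<and> (\<forall>xs. length xs = n \<longrightarrow> g xs = f xs))"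

abbreviation rec_on :: "nat \<Rightarrow> (nat list \<Rightarrow> nat) \<Rightarrow> bool" where
  "rec_on n f \<equiv> prec_on n (\<lambda>xs. Some (f xs))"

lemma partial_recursive_imp_prec_on: "partial_recursive g \<Longrightarrow> prec_on n g"
  by (auto simp: prec_on_def)

lemma prec_on_comp:
  assumes "prec_on m f" "length as = m" "\<And>a. a \<in> set as \<Longrightarrow> rec_on n a"
  shows "prec_on n (\<lambda>xs. f (map (\<lambda>a. a xs) as))"
proof -
  obtain F where F: "partial_recursive F" "\<And>xs. length xs = m \<Longrightarrow> F xs = f xs"
    using assms(1) by (auto simp: prec_on_def)
  have "\<forall>a\<in>set as. \<exists>g. partial_recursive g \<and> (\<forall>xs. length xs = n \<longrightarrow> g xs = Some (a xs))"
    using assms(3) by (simp add: prec_on_def)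
  then obtain k where k: "\<And>a. a \<in> set as \<Longrightarrow> partial_recursive (k a)"
    "\<And>a xs. a \<in> set as \<Longrightarrow> length xs = n \<Longrightarrow> k a xs = Some (a xs)"
    by (metis bchoice)
  have "comp_fn F (map k as) xs = f (map (\<lambda>a. a xs) as)" if "length xs = n" for xs
  proof -
    have "map (\<lambda>g. the (g xs)) (map k as) = map (\<lambda>a. a xs) as"
      using k(2) that by simp
    moreover have "\<forall>g\<in>set (map k as). g xs \<noteq> None"
      using k(2) that by simp
    ultimately show ?thesis
      using F(2) assms(2) by (simp only: comp_fn_def) simp
  qed
  moreover have "partial_recursive (comp_fn F (map k as))"
    using F(1) k(1) by (intro partial_recursive.comp) auto
  ultimately show ?thesis
    by (auto simp: prec_on_def)
qed

lemma prec_on_cong: "prec_on n f \<Longrightarrow> (\<And>xs. length xs = n \<Longrightarrow> f xs = g xs) \<Longrightarrow> prec_on n g"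
  by (auto simp: prec_on_def)

lemma rec_on_nth: "i < n \<Longrightarrow> rec_on n (\<lambda>xs. xs ! i)"
  using partial_recursive.proj[of i] by (auto simp: prec_on_def proj_fn_def)

lemma rec_on_Suc: "rec_on n a \<Longrightarrow> rec_on n (\<lambda>xs. Suc (a xs))"
  using prec_on_comp[of 1 succ_fn "[a]" n] partial_recursive_imp_prec_on[OF partial_recursive.succ]
  by (simp add: succ_fn_def)

lemma rec_on_const: "rec_on n (\<lambda>xs. c)"
proof (induction c)
  case 0
  show ?case using partial_recursive.zero unfolding prec_on_def zero_fn_def by blast
qed (rule rec_on_Suc)

text \<open>Base and step may both diverge, because the state transition iterated in the
  diagonalization is an unbounded search. Total recursion and composition with a partial inner
  function are derived from this case.\<close>

lemma prec_on_iter: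
  assumes "rec_on n a" "prec_on n z" "prec_on (n + 2) (\<lambda>ys. g (ys ! 0) (ys ! 1) (drop 2 ys))"
  shows "prec_on n (\<lambda>xs. rec_nat (z xs) (\<lambda>k r. Option.bind r (\<lambda>r. g k r xs)) (a xs))"
proof -
  obtain Z where Z: "partial_recursive Z" "\<And>xs. length xs = n \<Longrightarrow> Z xs = z xs"
    using assms(2) by (auto simp: prec_on_def)
  obtain G where G: "partial_recursive G"
      "\<And>ys. length ys = n + 2 \<Longrightarrow> G ys = g (ys ! 0) (ys ! 1) (drop 2 ys)"
    using assms(3) unfolding prec_on_def by blast
  have it: "iter_fn Z G k xs = rec_nat (z xs) (\<lambda>k r. Option.bind r (\<lambda>r. g k r xs)) k"
    if "length xs = n" for k xs
    by (induction k) (simp_all add: Z that G cong: Option.bind_cong)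
  have "prec_on n (\<lambda>xs. primrec_fn Z G (map (\<lambda>f. f xs) (a # map (\<lambda>i xs. xs ! i) [0..<n])))"
    by (rule prec_on_comp[where m = "Suc n"])
       (auto intro: assms rec_on_nth partial_recursive_imp_prec_on partial_recursive.prec Z G)
  moreover have "map ((\<lambda>f. f xs) \<circ> (\<lambda>i xs. xs ! i)) [0..<n] = xs" if "length xs = n" for xs :: "nat list"
    using that by (auto intro: nth_equalityI)
  ultimately show ?thesis
    by (elim prec_on_cong) (simp add: primrec_fn_def it)
qed

lemma rec_on_rec:
  assumes "rec_on n a" "rec_on n z" "rec_on (n + 2) (\<lambda>ys. g (ys ! 0) (ys ! 1) (drop 2 ys))"
  shows "rec_on n (\<lambda>xs. rec_nat (z xs) (\<lambda>k r. g k r xs) (a xs))"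
proof -
  have "rec_nat (Some (z xs)) (\<lambda>k r. Option.bind r (\<lambda>r. Some (g k r xs))) k
      = Some (rec_nat (z xs) (\<lambda>k r. g k r xs) k)" for k xs
    by (induction k) auto
  with prec_on_iter[OF assms(1,2), of "\<lambda>k r xs. Some (g k r xs)"] assms(3) show ?thesis
    by simp
qed

lemma rec_on_add: "rec_on n a \<Longrightarrow> rec_on n b \<Longrightarrow> rec_on n (\<lambda>xs. a xs + b xs)"
proof -
  assume *: "rec_on n a" "rec_on n b"
  have "rec_nat x (\<lambda>k r. Suc r) y = x + y" for x y
    by (induction y) auto
  thus ?thesis
    using rec_on_rec[OF *(2,1), of "\<lambda>k r xs. Suc r"] by (simp add: rec_on_Suc rec_on_nth)
qed

lemma rec_on_pred: "rec_on n a \<Longrightarrow> rec_on n (\<lambda>xs. a xs - 1)"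
proof -
  assume *: "rec_on n a"
  have "rec_nat 0 (\<lambda>k r. k) y = y - 1" for y
    by (induction y) auto
  thus ?thesis
    using rec_on_rec[OF * rec_on_const, of "\<lambda>k r xs. k" 0] by (simp add: rec_on_nth)
qed

lemma rec_on_diff: "rec_on n a \<Longrightarrow> rec_on n b \<Longrightarrow> rec_on n (\<lambda>xs. a xs - b xs)"
proof -
  assume *: "rec_on n a" "rec_on n b"
  have eq: "rec_nat x (\<lambda>k r. r - 1) y = x - y" for x y
    by (induction y) auto
  have "rec_on (n + 2) (\<lambda>ys. ys ! 1 - 1)"
    by (intro rec_on_pred rec_on_nth) simp
  from rec_on_rec[OF *(2,1), of "\<lambda>k r xs. r - 1", OF this] show ?thesis
    by (simp only: eq)
qed

text \<open>Truncated subtraction decides the test: \<open>a xs - b xs\<close> is 0 exactly in the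
  first case, and a recursion on this number that discards its accumulator returns its base value at
  0 and its step value elsewhere.\<close>

lemma rec_on_If:
  assumes "rec_on n a" "rec_on n b" "rec_on n c" "rec_on n d"
  shows "rec_on n (\<lambda>xs. if a xs \<le> b xs then c xs else d xs)"
proof -
  have "rec_nat x (\<lambda>k r. y) m = (if m = 0 then x else y)" for x y m :: nat
    by (cases m) auto
  moreover have "rec_on (n + 2) (\<lambda>ys. d (drop 2 ys))"
  proof (rule prec_on_cong)
    show "rec_on (n + 2) (\<lambda>ys. d (map (\<lambda>a. a ys) (map (\<lambda>i xs. xs ! i) [2..<n+2])))"
      by (rule prec_on_comp[OF assms(4)]) (auto intro: rec_on_nth)
    show "Some (d (map (\<lambda>a. a ys) (map (\<lambda>i xs. xs ! i) [2..<n+2]))) = Some (d (drop 2 ys))"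
      if "length ys = n + 2" for ys :: "nat list"
    proof -
      have "map (\<lambda>a. a ys) (map (\<lambda>i xs. xs ! i) [2..<n+2]) = drop 2 ys"
        using that by (intro nth_equalityI) (simp_all del: upt_Suc)
      thus ?thesis by (simp only:)
    qed
  qed
  ultimately show ?thesis
    using rec_on_rec[OF rec_on_diff[OF assms(1,2)] assms(3), of "\<lambda>k r. d"] by simp
qed

section \<open>Pairing and its inverses\<close>

lemma rec_on_triangle: "rec_on n a \<Longrightarrow> rec_on n (\<lambda>xs. triangle (a xs))"
proof -
  assume *: "rec_on n a"
  have "rec_nat 0 (\<lambda>k r. Suc (r + k)) m = triangle m" for m
    by (induction m) auto
  thus ?thesis
    using rec_on_rec[OF * rec_on_const, of "\<lambda>k r xs. Suc (r + k)" 0]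
    by (simp add: rec_on_nth rec_on_Suc rec_on_add)
qed

text \<open>For strictly increasing \<open>f\<close>, the largest \<open>s\<close> with \<open>f s \<le> n\<close>, or 0 if there is none.\<close>

definition floor_inv :: "(nat \<Rightarrow> nat) \<Rightarrow> nat \<Rightarrow> nat" where
  "floor_inv f = rec_nat 0 (\<lambda>k r. if f (Suc r) \<le> Suc k then Suc r else r)"

text \<open>One comparison per increment of \<open>n\<close> suffices, as \<open>f\<close> grows by
  at least 1 at each argument. Allowing \<open>f 0 = 1\<close> covers powers of 2, where the lower
  bound fails at \<open>n = 0\<close> only.\<close>

lemma floor_inv_bounds:
  assumes "f 0 \<le> Suc 0" "strict_mono f"
  shows "(f (floor_inv f n) \<le> n \<or> n = 0 \<and> floor_inv f n = 0) \<and> n < f (Suc (floor_inv f n))"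
proof (induction n)
  case 0
  show ?case using assms(1) strict_monoD[OF assms(2), of 0 1] by (auto simp: floor_inv_def)
next
  case (Suc n)
  let ?r = "floor_inv f n"
  have "floor_inv f (Suc n) = (if f (Suc ?r) \<le> Suc n then Suc ?r else ?r)"
    by (simp add: floor_inv_def)
  moreover have "f (Suc ?r) < f (Suc (Suc ?r))"
    by (rule strict_monoD[OF assms(2)]) simp
  moreover have "f ?r \<le> Suc n"
    using Suc assms(1) by auto
  ultimately show ?case using Suc by auto
qed

lemma floor_inv_eqI:
  assumes "f 0 \<le> Suc 0" "strict_mono f" "f s \<le> n" "n < f (Suc s)"
  shows "floor_inv f n = s"
proof -
  have "f (floor_inv f n) < f (Suc s)" if "n > 0"
    using floor_inv_bounds[OF assms(1,2), of n] assms(4) that by simp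
  moreover have "f s < f (Suc (floor_inv f n))"
    using floor_inv_bounds[OF assms(1,2), of n] assms(3) by simp
  ultimately show ?thesis
    using strict_mono_less[OF assms(2)] assms
    by (cases "n = 0") (auto simp: floor_inv_def less_Suc_eq)
qed

abbreviation p1 :: "nat \<Rightarrow> nat" where "p1 z \<equiv> fst (prod_decode z)"
abbreviation p2 :: "nat \<Rightarrow> nat" where "p2 z \<equiv> snd (prod_decode z)"

lemma strict_mono_triangle: "strict_mono triangle"
  by (simp add: strict_mono_Suc_iff)

text \<open>The code of \<open>(a, b)\<close> is \<open>triangle (a + b) + a\<close>, which lies
  below \<open>triangle (Suc (a + b))\<close>; so the floor inverse of \<open>triangle\<close>
  recovers \<open>a + b\<close>.\<close>

lemma p1_p2_eq:
  "p1 z = z - triangle (floor_inv triangle z)" "p2 z = floor_inv triangle z - p1 z"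
proof -
  obtain a b where z: "z = prod_encode (a, b)" by (metis prod.exhaust prod_decode_inverse)
  have "floor_inv triangle z = a + b"
    by (rule floor_inv_eqI[OF _ strict_mono_triangle]) (auto simp: z prod_encode_def)
  thus "p1 z = z - triangle (floor_inv triangle z)" "p2 z = floor_inv triangle z - p1 z"
    by (simp_all add: z) (simp add: prod_encode_def)
qed

lemma rec_on_floor_triangle: "rec_on n a \<Longrightarrow> rec_on n (\<lambda>xs. floor_inv triangle (a xs))"
  unfolding floor_inv_def
  by (rule rec_on_rec)
     (assumption | rule rec_on_If rec_on_triangle rec_on_Suc rec_on_nth rec_on_const | simp)+

lemma rec_on_p1: "rec_on n a \<Longrightarrow> rec_on n (\<lambda>xs. p1 (a xs))"
  unfolding p1_p2_eq by (intro rec_on_diff rec_on_triangle rec_on_floor_triangle)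

lemma rec_on_p2: "rec_on n a \<Longrightarrow> rec_on n (\<lambda>xs. p2 (a xs))"
  by (subst p1_p2_eq) (intro rec_on_diff rec_on_p1 rec_on_floor_triangle)

lemma rec_on_prod_encode:
  "rec_on n a \<Longrightarrow> rec_on n b \<Longrightarrow> rec_on n (\<lambda>xs. prod_encode (a xs, b xs))"
  unfolding prod_encode_def by (simp add: rec_on_add rec_on_triangle)

section \<open>Computability of unary functions on coded tuples\<close>

lemma partial_computable_iff: "partial_computable f \<longleftrightarrow> prec_on 1 (\<lambda>xs. f (xs ! 0))"
proof -
  have "(\<forall>x. g [x] = f x) \<longleftrightarrow> (\<forall>xs. length xs = 1 \<longrightarrow> g xs = f (xs ! 0))" for g
    by (auto simp: length_Suc_conv)
  thus ?thesis by (simp add: partial_computable_def prec_on_def)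
qed

lemma prec_on_partial_computable:
  "partial_computable f \<Longrightarrow> rec_on n a \<Longrightarrow> prec_on n (\<lambda>xs. f (a xs))"
  using prec_on_comp[of 1 "\<lambda>xs. f (xs ! 0)" "[a]" n] by (simp add: partial_computable_iff)

lemma partial_computable2_iff:
  "partial_computable2 f \<longleftrightarrow> partial_computable (\<lambda>z. f (p1 z) (p2 z))"
proof -
  have eq: "(\<forall>x y. g [x, y] = f x y) \<longleftrightarrow> (\<forall>xs. length xs = 2 \<longrightarrow> g xs = f (xs ! 0) (xs ! 1))" for g
    by (auto simp: length_Suc_conv numeral_2_eq_2)
  hence iff: "partial_computable2 f \<longleftrightarrow> prec_on 2 (\<lambda>xs. f (xs ! 0) (xs ! 1))"
    by (simp add: partial_computable2_def prec_on_def)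
  show ?thesis
  proof
    assume "partial_computable2 f"
    hence "prec_on 2 (\<lambda>xs. f (xs ! 0) (xs ! 1))"
      by (simp only: iff)
    hence "prec_on 1 (\<lambda>xs. (\<lambda>ys. f (ys ! 0) (ys ! 1))
        (map (\<lambda>a. a xs) [\<lambda>xs. p1 (xs ! 0), \<lambda>xs. p2 (xs ! 0)]))"
      by (rule prec_on_comp) (auto intro: rec_on_p1 rec_on_p2 rec_on_nth)
    thus "partial_computable (\<lambda>z. f (p1 z) (p2 z))"
      by (simp add: partial_computable_iff)
  next
    assume "partial_computable (\<lambda>z. f (p1 z) (p2 z))"
    from prec_on_partial_computable[OF this, of 2 "\<lambda>xs. prod_encode (xs ! 0, xs ! 1)"]
    show "partial_computable2 f"
      by (simp add: iff rec_on_prod_encode rec_on_nth)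
  qed
qed

lemma total_computable_iff: "total_computable f \<longleftrightarrow> rec_on 1 (\<lambda>xs. f (xs ! 0))"
  by (simp add: total_computable_def partial_computable_iff)

lemma partial_computable_comp:
  "partial_computable f \<Longrightarrow> total_computable a \<Longrightarrow> partial_computable (\<lambda>z. f (a z))"
  unfolding total_computable_iff partial_computable_iff[of "\<lambda>z. f (a z)"]
  by (rule prec_on_partial_computable)

lemma tc_comp: "total_computable f \<Longrightarrow> total_computable a \<Longrightarrow> total_computable (\<lambda>z. f (a z))"
  unfolding total_computable_def[of f] total_computable_def[of "\<lambda>z. f (a z)"]
  by (rule partial_computable_comp)

lemma tc_const: "total_computable (\<lambda>z. c)"
  and tc_id: "total_computable (\<lambda>z. z)"
  and tc_Suc: "total_computable a \<Longrightarrow> total_computable (\<lambda>z. Suc (a z))"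
  and tc_p1: "total_computable a \<Longrightarrow> total_computable (\<lambda>z. p1 (a z))"
  and tc_p2: "total_computable a \<Longrightarrow> total_computable (\<lambda>z. p2 (a z))"
  and tc_prod_encode: "total_computable a \<Longrightarrow> total_computable b \<Longrightarrow> total_computable (\<lambda>z. prod_encode (a z, b z))"
  and tc_add: "total_computable a \<Longrightarrow> total_computable b \<Longrightarrow> total_computable (\<lambda>z. a z + b z)"
  and tc_diff: "total_computable a \<Longrightarrow> total_computable b \<Longrightarrow> total_computable (\<lambda>z. a z - b z)"
  by (simp_all add: total_computable_iff rec_on_const rec_on_nth rec_on_Suc rec_on_p1 rec_on_p2
      rec_on_prod_encode rec_on_add rec_on_diff)

text \<open>The step is curried while its computability is stated on codes of triples, so that the
  rule applies by resolution to functions written as lambda terms.\<close>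

lemma pc_iter:
  assumes "total_computable a" "partial_computable z"
    "partial_computable (\<lambda>w. g (p1 w) (p1 (p2 w)) (p2 (p2 w)))"
  shows "partial_computable
    (\<lambda>x. rec_nat (z x) (\<lambda>k r. Option.bind r (g x k)) (a x))"
proof -
  have "prec_on (1 + 2) (\<lambda>ys. g (ys ! 2) (ys ! 0) (ys ! 1))"
    using prec_on_partial_computable[OF assms(3),
        of "1 + 2" "\<lambda>ys. prod_encode (ys ! 2, prod_encode (ys ! 0, ys ! 1))"]
    by (simp add: rec_on_prod_encode rec_on_nth)
  hence "prec_on (1 + 2) (\<lambda>ys. g (drop 2 ys ! 0) (ys ! 0) (ys ! 1))"
    by (rule prec_on_cong) simp
  thus ?thesis
    using assms(1,2) prec_on_iter[of 1 "\<lambda>xs. a (xs ! 0)" "\<lambda>xs. z (xs ! 0)" "\<lambda>k r xs. g (xs ! 0) k r"]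
    by (simp add: total_computable_iff partial_computable_iff)
qed

lemma tc_rec:
  assumes "total_computable a" "total_computable z"
    "total_computable (\<lambda>w. g (p1 w) (p1 (p2 w)) (p2 (p2 w)))"
  shows "total_computable (\<lambda>x. rec_nat (z x) (g x) (a x))"
proof -
  have "rec_nat (Some (z x)) (\<lambda>k r. Option.bind r (\<lambda>r. Some (g x k r))) k
      = Some (rec_nat (z x) (g x) k)" for k x
    by (induction k) auto
  with pc_iter[OF assms(1), of "\<lambda>x. Some (z x)" "\<lambda>x k r. Some (g x k r)"] assms(2,3) show ?thesis
    by (simp add: total_computable_def)
qed

lemma pc_Some: "total_computable a \<Longrightarrow> partial_computable (\<lambda>x. Some (a x))"
  by (simp add: total_computable_def)

text \<open>A bind is an iteration with exactly one round.\<close>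

lemma pc_bind:
  assumes "partial_computable f" "partial_computable (\<lambda>w. g (p1 w) (p2 w))"
  shows "partial_computable (\<lambda>x. Option.bind (f x) (g x))"
proof -
  have "partial_computable (\<lambda>w. g (p1 w) (p2 (p2 w)))"
    using partial_computable_comp[OF assms(2), of "\<lambda>w. prod_encode (p1 w, p2 (p2 w))"]
    by (simp add: tc_prod_encode tc_p1 tc_p2 tc_id)
  from pc_iter[OF tc_const[of 1] assms(1) this] show ?thesis
    by simp
qed

lemma tc_if_le:
  assumes "total_computable a" "total_computable b" "total_computable c" "total_computable d"
  shows "total_computable (\<lambda>z. if a z \<le> b z then c z else d z)"
  using assms rec_on_If by (simp add: total_computable_iff)

section \<open>Decidable predicates, bounded quantification and unbounded search\<close>

definition decidable :: "(nat \<Rightarrow> bool) \<Rightarrow> bool" where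
  "decidable p \<longleftrightarrow> total_computable (\<lambda>x. if p x then 1 else 0)"

lemma tc_if:
  assumes "decidable p" "total_computable a" "total_computable b"
  shows "total_computable (\<lambda>z. if p z then a z else b z)"
proof -
  have "(\<lambda>z. if 1 \<le> (if p z then 1 else 0 :: nat) then a z else b z) = (\<lambda>z. if p z then a z else b z)"
    by auto
  thus ?thesis
    using tc_if_le[OF tc_const[of 1] assms(1)[unfolded decidable_def] assms(2,3)] by (simp only:)
qed

lemma dec_comp: "decidable p \<Longrightarrow> total_computable a \<Longrightarrow> decidable (\<lambda>z. p (a z))"
  unfolding decidable_def by (rule tc_comp)

lemma dec_le:
  "total_computable a \<Longrightarrow> total_computable b \<Longrightarrow> decidable (\<lambda>z. a z \<le> b z)"
  unfolding decidable_def by (intro tc_if_le tc_const)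

lemma dec_not: "decidable p \<Longrightarrow> decidable (\<lambda>z. \<not> p z)"
proof -
  assume "decidable p"
  hence "total_computable (\<lambda>z. if p z then 0 else 1)"
    by (intro tc_if tc_const)
  moreover have "(\<lambda>z. if p z then 0 else 1 :: nat) = (\<lambda>z. if \<not> p z then 1 else 0)"
    by auto
  ultimately show ?thesis by (simp only: decidable_def)
qed

lemma dec_conj: "decidable p \<Longrightarrow> decidable q \<Longrightarrow> decidable (\<lambda>z. p z \<and> q z)"
  using tc_if[OF _ _ tc_const[of 0], of p "\<lambda>z. if q z then 1 else 0"]
  by (simp only: decidable_def if_if_eq_conj)

lemma dec_disj: "decidable p \<Longrightarrow> decidable q \<Longrightarrow> decidable (\<lambda>z. p z \<or> q z)"
  using dec_not[OF dec_conj[OF dec_not dec_not], of p q] by simp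

lemma dec_eq:
  "total_computable a \<Longrightarrow> total_computable b \<Longrightarrow> decidable (\<lambda>z. a z = b z)"
  unfolding order_eq_iff by (intro dec_conj dec_le)

lemma dec_bex:
  assumes "total_computable a" "decidable (\<lambda>w. p (p1 w) (p2 w))"
  shows "decidable (\<lambda>z. \<exists>t\<le>a z. p z t)"
proof -
  have "rec_nat 0 (\<lambda>k r. if p z k then 1 else r) n = (if \<exists>t<n. p z t then 1 else 0 :: nat)" for z n
    by (induction n) (auto simp: less_Suc_eq)
  moreover have "decidable (\<lambda>w. p (p1 w) (p1 (p2 w)))"
    using dec_comp[OF assms(2) tc_prod_encode[OF tc_p1[OF tc_id] tc_p1[OF tc_p2[OF tc_id]]]]
    by (simp only: prod_encode_inverse fst_conv snd_conv)
  hence "total_computable (\<lambda>z. rec_nat 0 (\<lambda>k r. if p z k then 1 else r) (Suc (a z)))"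
    by (intro tc_rec tc_if tc_const tc_p2 tc_id tc_Suc assms(1))
  ultimately show ?thesis
    by (simp only: less_Suc_eq_le decidable_def)
qed

text \<open>For a decidable predicate the searched function is total, so the convergence demanded by
  \<open>first_zero\<close> below the zero is automatic.\<close>

lemma pc_mu:
  assumes "decidable (\<lambda>w. p (p1 w) (p2 w))"
  shows "partial_computable (\<lambda>z. if \<exists>n. p z n then Some (LEAST n. p z n) else None)"
proof -
  have "total_computable (\<lambda>w. if p (p1 w) (p2 w) then 0 else 1)"
    by (intro tc_if assms tc_const)
  \<comment> \<open>The search variable is the first list entry in \<open>first_zero\<close>, hence
    the swap.\<close>
  hence "rec_on 2 (\<lambda>xs. if p (xs ! 1) (xs ! 0) then 0 else 1)"
    using prec_on_partial_computable[of "\<lambda>w. Some (if p (p1 w) (p2 w) then 0 else 1)" 2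
        "\<lambda>xs. prod_encode (xs ! 1, xs ! 0)"]
    by (simp add: total_computable_def rec_on_prod_encode rec_on_nth cong: if_cong)
  then obtain g where g: "partial_recursive g"
      "\<And>n z. g [n, z] = Some (if p z n then 0 else 1)"
    unfolding prec_on_def by (auto cong: if_cong)
  have fz: "first_zero g [z] n \<longleftrightarrow> p z n \<and> (\<forall>m<n. \<not> p z m)" for z n
    by (auto simp: first_zero_def g)
  have ex: "(\<exists>n. first_zero g [z] n) \<longleftrightarrow> (\<exists>n. p z n)" for z
    using LeastI_ex[of "p z"] not_less_Least[of _ "p z"] unfolding fz by blast
  have "mu_fn g [z] = (if \<exists>n. p z n then Some (LEAST n. p z n) else None)" for z
  proof (cases "\<exists>n. p z n")
    case True
    have "first_zero g [z] n \<longleftrightarrow> n = (LEAST n. p z n)" for n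
      using LeastI_ex[OF True] not_less_Least[of _ "p z"] Least_le[of "p z" n]
      unfolding fz by (metis linorder_neqE_nat not_less)
    hence "(THE n. first_zero g [z] n) = (LEAST n. p z n)"
      by simp
    with True ex show ?thesis by (simp add: mu_fn_def)
  qed (simp add: mu_fn_def ex)
  thus ?thesis
    unfolding partial_computable_def using partial_recursive.mu[OF g(1)] by blast
qed

lemmas tc_intros = tc_const tc_id tc_Suc tc_p1 tc_p2 tc_prod_encode tc_add tc_diff tc_if tc_rec
  dec_le dec_eq dec_not dec_conj dec_disj dec_bex

section \<open>Computing with codes of lists and sets\<close>

text \<open>A nonzero list code is the successor of a pair of head and tail code. Since 0 decodes to
  the pair of zeros, the formula also sends the empty list to itself.\<close>

lemma list_decode_tl: "list_decode (p2 (c - 1)) = tl (list_decode c)"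
proof (cases c)
  case 0
  have "prod_decode 0 = (0, 0)" by (simp add: prod_decode_def prod_decode_aux.simps)
  with 0 show ?thesis by simp
qed (simp add: split_def)

lemma list_decode_hd: "c \<noteq> 0 \<Longrightarrow> p1 (c - 1) = hd (list_decode c)"
  by (cases c) (simp_all add: split_def)

lemma list_decode_eq_Nil: "list_decode c = [] \<longleftrightarrow> c = 0"
  by (metis list_decode.simps(1) list_decode_inverse list_encode.simps(1))

lemma length_le_list_encode: "length xs \<le> list_encode xs"
  by (induction xs) (auto intro: le_trans le_prod_encode_2)

definition drop_code :: "nat \<Rightarrow> nat \<Rightarrow> nat" where
  "drop_code c k = rec_nat c (\<lambda>k r. p2 (r - 1)) k"

lemma list_decode_drop_code: "list_decode (drop_code c k) = drop k (list_decode c)"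
  by (induction k) (simp_all add: drop_code_def list_decode_tl[simplified] tl_drop drop_Suc)

lemma tc_drop_code: "total_computable a \<Longrightarrow> total_computable b \<Longrightarrow> total_computable (\<lambda>z. drop_code (a z) (b z))"
  unfolding drop_code_def by (intro tc_intros)

text \<open>A list is no longer than its code, so the code itself bounds the search for a
  position.\<close>

lemma mem_list_decode_iff:
  "x \<in> set (list_decode c) \<longleftrightarrow> (\<exists>k\<le>c. drop_code c k \<noteq> 0 \<and> p1 (drop_code c k - 1) = x)"
proof -
  have nz: "drop_code c k \<noteq> 0 \<longleftrightarrow> k < length (list_decode c)" for k
    using list_decode_eq_Nil[of "drop_code c k"] by (auto simp: list_decode_drop_code)
  have "p1 (drop_code c k - 1) = list_decode c ! k" if "k < length (list_decode c)" for k
    using list_decode_hd[of "drop_code c k"] nz[of k] that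
    by (simp add: list_decode_drop_code hd_drop_conv_nth)
  moreover have "length (list_decode c) \<le> c"
    using length_le_list_encode[of "list_decode c"] by simp
  ultimately show ?thesis
    unfolding in_set_conv_nth nz by (metis less_imp_le less_le_trans)
qed

lemma dec_mem:
  assumes "total_computable a" "total_computable b"
  shows "decidable (\<lambda>z. b z \<in> set (list_decode (a z)))"
  unfolding mem_list_decode_iff
  by (intro dec_bex assms dec_conj dec_not dec_eq tc_drop_code tc_p1 tc_p2 tc_diff tc_id tc_const
      tc_comp[OF assms(1)] tc_comp[OF assms(2)])

text \<open>Reversal with an accumulator: the head of the second list moves to the front of the
  first. An empty rest is a fixed point, so surplus rounds do no harm and the code of the list can
  serve as their number.\<close>

definition rev_step :: "nat \<Rightarrow> nat" where
  "rev_step r = (if p2 r = 0 then r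
     else prod_encode (Suc (prod_encode (p1 (p2 r - 1), p1 r)), p2 (p2 r - 1)))"

lemma rev_step_iter:
  "rec_nat (prod_encode (0, list_encode xs)) (\<lambda>k. rev_step) k =
     prod_encode (list_encode (rev (take k xs)), list_encode (drop k xs))"
proof (induction k)
  case (Suc k)
  have *: "rec_nat (prod_encode (0, list_encode xs)) (\<lambda>k. rev_step) (Suc k) =
     rev_step (prod_encode (list_encode (rev (take k xs)), list_encode (drop k xs)))"
    by (simp add: Suc)
  show ?case
  proof (cases "k < length xs")
    case True
    hence "list_encode (drop k xs) = Suc (prod_encode (xs ! k, list_encode (drop (Suc k) xs)))"
      by (subst Cons_nth_drop_Suc[symmetric]) simp_all
    with True show ?thesis
      unfolding * by (simp add: rev_step_def take_Suc_conv_app_nth)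
  qed (unfold *, simp add: rev_step_def)
qed simp

lemma tc_rev_step: "total_computable a \<Longrightarrow> total_computable (\<lambda>z. rev_step (a z))"
  unfolding rev_step_def by (intro tc_intros)

lemma tc_list_encode_rev:
  assumes "total_computable a"
  shows "total_computable (\<lambda>z. list_encode (rev (list_decode (a z))))"
proof -
  have "list_encode (rev (list_decode c)) = p1 (rec_nat (prod_encode (0, c)) (\<lambda>k. rev_step) c)" for c
    using rev_step_iter[of "list_decode c" c] length_le_list_encode[of "list_decode c"] by simp
  moreover have "total_computable (\<lambda>z. p1 (rec_nat (prod_encode (0, a z)) (\<lambda>k. rev_step) (a z)))"
    by (intro tc_intros tc_rev_step assms)
  ultimately show ?thesis by simp
qed

definition max_code :: "nat \<Rightarrow> nat" where
  "max_code = floor_inv (\<lambda>n. 2 ^ n)"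

text \<open>The code of \<open>D\<close> has exactly the binary digits in \<open>D\<close> set, so
  its leading digit is at position \<open>Max D\<close>.\<close>

lemma max_code_set_encode:
  assumes "finite D" "D \<noteq> {}"
  shows "max_code (set_encode D) = Max D"
  unfolding max_code_def
proof (rule floor_inv_eqI)
  have "(2::nat) ^ Max D = sum ((^) 2) {Max D}" by simp
  also have "\<dots> \<le> set_encode D"
    unfolding set_encode_def using assms by (intro sum_mono2) auto
  finally show "2 ^ Max D \<le> set_encode D" .
  have "set_encode D \<le> sum ((^) 2) {0..<Suc (Max D)}"
    unfolding set_encode_def using assms by (intro sum_mono2) (auto simp: less_Suc_eq_le)
  also have "\<dots> < 2 ^ Suc (Max D)"
    by (simp only: sum_power2) simp
  finally show "set_encode D < 2 ^ Suc (Max D)" .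
qed (auto simp: strict_mono_def)

lemma tc_max_code: "total_computable max_code"
proof -
  have "2 ^ n = rec_nat (1 :: nat) (\<lambda>k r. r + r) n" for n
    by (induction n) auto
  hence "total_computable (\<lambda>z. rec_nat 0 (\<lambda>k r. if 2 ^ Suc r \<le> Suc k then Suc r else r) z)"
    by (simp only:) (intro tc_intros)
  thus ?thesis by (simp add: max_code_def floor_inv_def)
qed

section \<open>Graphs of partial computable functions\<close>

text \<open>\<open>H r z\<close> is 0 while stage \<open>r\<close> has found no value and
  \<open>Suc v\<close> once the value \<open>v\<close> is found. Persistence in \<open>r\<close>
  lets the stages of several subcomputations be replaced by their maximum.\<close>

definition approximates :: "(nat \<Rightarrow> nat \<Rightarrow> nat) \<Rightarrow> (nat list \<Rightarrow> nat option) \<Rightarrow> bool" where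
  "approximates H f \<longleftrightarrow> total_computable (\<lambda>w. H (p1 w) (p2 w)) \<and>
     (\<forall>r r' z v. r \<le> r' \<longrightarrow> H r z = Suc v \<longrightarrow> H r' z = Suc v) \<and>
     (\<forall>xs v. f xs = Some v \<longleftrightarrow> (\<exists>r. H r (list_encode xs) = Suc v))"

lemma approximatesI:
  assumes "total_computable (\<lambda>w. H (p1 w) (p2 w))"
    "\<And>r r' z v. r \<le> r' \<Longrightarrow> H r z = Suc v \<Longrightarrow> H r' z = Suc v"
    "\<And>xs v. f xs = Some v \<longleftrightarrow> (\<exists>r. H r (list_encode xs) = Suc v)"
  shows "approximates H f"
  using assms by (auto simp: approximates_def)

lemma approximatesD:
  assumes "approximates H f"
  shows "total_computable a \<Longrightarrow> total_computable b \<Longrightarrow> total_computable (\<lambda>z. H (a z) (b z))"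
    "r \<le> r' \<Longrightarrow> H r z = Suc v \<Longrightarrow> H r' z = Suc v"
    "f xs = Some v \<longleftrightarrow> (\<exists>r. H r (list_encode xs) = Suc v)"
proof -
  have H: "total_computable (\<lambda>w. H (p1 w) (p2 w))"
    using assms by (simp add: approximates_def)
  show "total_computable (\<lambda>z. H (a z) (b z))" if "total_computable a" "total_computable b"
    using tc_comp[OF H tc_prod_encode[OF that]] by simp
qed (use assms in \<open>auto simp: approximates_def\<close>)

lemma approximates_zero: "approximates (\<lambda>r z. 1) zero_fn"
  by (rule approximatesI) (auto simp: zero_fn_def intro: tc_const)

lemma approximates_proj:
  "approximates (\<lambda>r z. if drop_code z i = 0 then 0 else Suc (p1 (drop_code z i - 1))) (proj_fn i)"
proof (rule approximatesI)
  show "total_computable (\<lambda>w. if drop_code (p2 w) i = 0 then 0 else Suc (p1 (drop_code (p2 w) i - 1)))"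
    by (intro tc_if dec_eq tc_drop_code tc_intros)
  fix xs v
  have "drop_code (list_encode xs) i = 0 \<longleftrightarrow> \<not> i < length xs"
    using list_decode_eq_Nil[of "drop_code (list_encode xs) i"] by (auto simp: list_decode_drop_code)
  thus "(proj_fn i xs = Some v) = (\<exists>r :: nat. (if drop_code (list_encode xs) i = 0 then 0
      else Suc (p1 (drop_code (list_encode xs) i - 1))) = Suc v)"
    using list_decode_hd[of "drop_code (list_encode xs) i"]
    by (auto simp: proj_fn_def list_decode_drop_code hd_drop_conv_nth)
qed auto

lemma approximates_succ:
  "approximates (\<lambda>r z. if z = 0 then 0 else Suc (Suc (p1 (z - 1)))) succ_fn"
proof (rule approximatesI)
  show "total_computable (\<lambda>w. if p2 w = 0 then 0 else Suc (Suc (p1 (p2 w - 1))))"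
    by (intro tc_intros)
  show "(succ_fn xs = Some v) = (\<exists>r :: nat. (if list_encode xs = 0 then 0
      else Suc (Suc (p1 (list_encode xs - 1)))) = Suc v)" for xs v
    by (cases xs) (auto simp: succ_fn_def)
qed auto

text \<open>Collecting the inner values in one list code allows induction on \<open>gs\<close> and
  reduces composition to a single inner function.\<close>

lemma approximates_comp_list:
  assumes "\<And>g. g \<in> set gs \<Longrightarrow> \<exists>H. approximates H g"
  shows "\<exists>K. approximates K (\<lambda>xs. if \<forall>g\<in>set gs. g xs \<noteq> None
           then Some (list_encode (map (\<lambda>g. the (g xs)) gs)) else None)"
  using assms
proof (induction gs)
  case Nil
  have "approximates (\<lambda>r z. 1) (\<lambda>xs. Some 0)"
    using approximates_zero by (simp add: zero_fn_def[abs_def])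
  thus ?case by auto
next
  case (Cons g gs)
  let ?f = "\<lambda>gs xs. if \<forall>g\<in>set gs. g xs \<noteq> None
           then Some (list_encode (map (\<lambda>g. the (g xs)) gs)) else None"
  obtain K where K: "approximates K (?f gs)"
    using Cons by auto
  obtain H where H: "approximates H g"
    using Cons.prems[of g] by auto
  \<comment> \<open>One of the two outer successors marks convergence, the other belongs to the code
    of a nonempty list.\<close>
  let ?K = "\<lambda>r z. if H r z = 0 \<or> K r z = 0 then 0 else Suc (Suc (prod_encode (H r z - 1, K r z - 1)))"
  have "approximates ?K (?f (g # gs))"
  proof (rule approximatesI)
    show "total_computable (\<lambda>w. ?K (p1 w) (p2 w))"
      by (intro tc_if dec_disj dec_eq tc_Suc tc_prod_encode tc_diff tc_const approximatesD(1)[OF H]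
          approximatesD(1)[OF K] tc_p1 tc_p2 tc_id)
    show "?K r' z = Suc v" if "r \<le> r'" "?K r z = Suc v" for r r' z v
      using that approximatesD(2)[OF H that(1), of z "H r z - 1"]
        approximatesD(2)[OF K that(1), of z "K r z - 1"] by (auto split: if_splits)
    fix xs v
    let ?z = "list_encode xs"
    show "(?f (g # gs) xs = Some v) \<longleftrightarrow> (\<exists>r. ?K r ?z = Suc v)"
    proof
      assume "?f (g # gs) xs = Some v"
      then obtain a b where ab: "g xs = Some a" "?f gs xs = Some b" "v = Suc (prod_encode (a, b))"
        by (auto split: if_splits)
      from ab(1) obtain r1 where r1: "H r1 ?z = Suc a"
        using approximatesD(3)[OF H] by auto
      from ab(2) obtain r2 where r2: "K r2 ?z = Suc b"
        using approximatesD(3)[OF K, of xs b] by blast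
      have "H (max r1 r2) ?z = Suc a" "K (max r1 r2) ?z = Suc b"
        using approximatesD(2)[OF H _ r1] approximatesD(2)[OF K _ r2] by simp_all
      thus "\<exists>r. ?K r ?z = Suc v" using ab(3) by (intro exI[of _ "max r1 r2"]) simp
    next
      assume "\<exists>r. ?K r ?z = Suc v"
      then obtain r a b where r: "H r ?z = Suc a" "K r ?z = Suc b" "v = Suc (prod_encode (a, b))"
        by (auto split: if_splits simp: gr0_conv_Suc)
      have "g xs = Some a" "?f gs xs = Some b"
        using approximatesD(3)[OF H] approximatesD(3)[OF K, of xs b] r by blast+
      thus "?f (g # gs) xs = Some v"
        using r(3) by (auto split: if_splits)
    qed
  qed
  thus ?case by blast
qed

lemma approximates_comp:
  assumes "approximates F f" "\<And>g. g \<in> set gs \<Longrightarrow> \<exists>H. approximates H g"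
  shows "\<exists>H. approximates H (comp_fn f gs)"
proof -
  let ?f = "\<lambda>xs. if \<forall>g\<in>set gs. g xs \<noteq> None
           then Some (list_encode (map (\<lambda>g. the (g xs)) gs)) else None"
  obtain K where K: "approximates K ?f"
    using approximates_comp_list[OF assms(2)] by blast
  note F = assms(1)
  have "approximates (\<lambda>r z. if K r z = 0 then 0 else F r (K r z - 1)) (comp_fn f gs)"
  proof (rule approximatesI)
    show "total_computable (\<lambda>w. if K (p1 w) (p2 w) = 0 then 0 else F (p1 w) (K (p1 w) (p2 w) - 1))"
      by (intro tc_if dec_eq tc_diff tc_const approximatesD(1)[OF F] approximatesD(1)[OF K] tc_p1 tc_p2 tc_id)
    show "(if K r' z = 0 then 0 else F r' (K r' z - 1)) = Suc v"
      if "r \<le> r'" "(if K r z = 0 then 0 else F r (K r z - 1)) = Suc v" for r r' z v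
      using that approximatesD(2)[OF F that(1), of "K r z - 1" v]
        approximatesD(2)[OF K that(1), of z "K r z - 1"] by (auto split: if_splits)
    fix xs v
    let ?z = "list_encode xs"
    have "comp_fn f gs xs = Some v \<longleftrightarrow> (\<exists>c. ?f xs = Some c \<and> f (list_decode c) = Some v)"
      by (auto simp: comp_fn_def)
    also have "\<dots> \<longleftrightarrow> (\<exists>r. (if K r ?z = 0 then 0 else F r (K r ?z - 1)) = Suc v)"
    proof
      assume "\<exists>c. ?f xs = Some c \<and> f (list_decode c) = Some v"
      then obtain c where c: "?f xs = Some c" "f (list_decode c) = Some v" by blast
      from c(1) obtain r1 where r1: "K r1 ?z = Suc c"
        using approximatesD(3)[OF K, of xs c] by blast
      from c(2) obtain r2 where r2: "F r2 c = Suc v"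
        using approximatesD(3)[OF F, of "list_decode c"] by auto
      have "K (max r1 r2) ?z = Suc c" "F (max r1 r2) c = Suc v"
        using approximatesD(2)[OF K _ r1] approximatesD(2)[OF F _ r2] by simp_all
      thus "\<exists>r. (if K r ?z = 0 then 0 else F r (K r ?z - 1)) = Suc v"
        by (intro exI[of _ "max r1 r2"]) simp
    next
      assume "\<exists>r. (if K r ?z = 0 then 0 else F r (K r ?z - 1)) = Suc v"
      then obtain r c where r: "K r ?z = Suc c" "F r c = Suc v"
        by (auto split: if_splits simp: gr0_conv_Suc)
      have "?f xs = Some c" "f (list_decode c) = Some v"
        using approximatesD(3)[OF K, of xs c] approximatesD(3)[OF F, of "list_decode c" v] r
        by (blast, auto)
      thus "\<exists>c. ?f xs = Some c \<and> f (list_decode c) = Some v" by blast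
    qed
    finally show "comp_fn f gs xs = Some v \<longleftrightarrow> (\<exists>r. (if K r ?z = 0 then 0 else F r (K r ?z - 1)) = Suc v)" .
  qed
  thus ?thesis by blast
qed

lemma approximates_primrec:
  assumes F: "approximates F f" and K: "approximates K g"
  shows "\<exists>H. approximates H (primrec_fn f g)"
proof -
  \<comment> \<open>All rounds share the stage \<open>r\<close>, and an undecided round makes all
    later rounds undecided. The argument passed to \<open>K\<close> is the code of the list
    consisting of \<open>n\<close>, the previous value and the parameters coded by
    \<open>y\<close>.\<close>
  define I where "I = (\<lambda>r y. rec_nat (F r y)
    (\<lambda>n a. if a = 0 then 0 else K r (Suc (prod_encode (n, Suc (prod_encode (a - 1, y)))))))"
  have I_simps: "I r y 0 = F r y" "I r y (Suc n) = (if I r y n = 0 then 0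
      else K r (Suc (prod_encode (n, Suc (prod_encode (I r y n - 1, y))))))" for r y n
    by (simp_all add: I_def)
  have mono: "I r' y n = Suc v" if "r \<le> r'" "I r y n = Suc v" for r r' y n v
    using that(2)
  proof (induction n arbitrary: v)
    case 0
    thus ?case using approximatesD(2)[OF F that(1)] by (simp add: I_simps)
  next
    case (Suc n)
    then obtain u where "I r y n = Suc u" by (cases "I r y n") (auto simp: I_simps)
    with Suc show ?case using approximatesD(2)[OF K that(1)] by (simp add: I_simps)
  qed
  have iter: "iter_fn f g n ys = Some v \<longleftrightarrow> (\<exists>r. I r (list_encode ys) n = Suc v)" for n ys v
  proof (induction n arbitrary: v)
    case 0
    thus ?case by (simp add: I_simps approximatesD(3)[OF F])
  next
    case (Suc n)
    let ?c = "\<lambda>u. Suc (prod_encode (n, Suc (prod_encode (u, list_encode ys))))"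
    have "iter_fn f g (Suc n) ys = Some v \<longleftrightarrow>
        (\<exists>u r1 r2. I r1 (list_encode ys) n = Suc u \<and> K r2 (?c u) = Suc v)"
      using approximatesD(3)[OF K, of "n # _ # ys" v]
      by (auto simp: bind_eq_Some_conv Suc)
    also have "\<dots> \<longleftrightarrow> (\<exists>r u. I r (list_encode ys) n = Suc u \<and> K r (?c u) = Suc v)"
    proof safe
      fix u r1 r2 assume "I r1 (list_encode ys) n = Suc u" "K r2 (?c u) = Suc v"
      hence "I (max r1 r2) (list_encode ys) n = Suc u" "K (max r1 r2) (?c u) = Suc v"
        using mono[of r1 "max r1 r2"] approximatesD(2)[OF K, of r2 "max r1 r2"] by simp_all
      thus "\<exists>r u. I r (list_encode ys) n = Suc u \<and> K r (?c u) = Suc v" by blast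
    qed blast
    also have "\<dots> \<longleftrightarrow> (\<exists>r. I r (list_encode ys) (Suc n) = Suc v)"
    proof (intro ex_cong1)
      show "(\<exists>u. I r (list_encode ys) n = Suc u \<and> K r (?c u) = Suc v) \<longleftrightarrow>
          I r (list_encode ys) (Suc n) = Suc v" for r
        by (cases "I r (list_encode ys) n") (simp_all add: I_simps)
    qed
    finally show ?case .
  qed
  have "approximates (\<lambda>r z. if z = 0 then 0 else I r (p2 (z - 1)) (p1 (z - 1))) (primrec_fn f g)"
  proof (rule approximatesI)
    show "total_computable (\<lambda>w. if p2 w = 0 then 0 else I (p1 w) (p2 (p2 w - 1)) (p1 (p2 w - 1)))"
      unfolding I_def
      by (intro tc_if dec_eq tc_rec tc_Suc tc_prod_encode approximatesD(1)[OF F] approximatesD(1)[OF K]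
          tc_diff tc_p1 tc_p2 tc_const tc_id)
    show "(if z = 0 then 0 else I r' (p2 (z - 1)) (p1 (z - 1))) = Suc v"
      if "r \<le> r'" "(if z = 0 then 0 else I r (p2 (z - 1)) (p1 (z - 1))) = Suc v" for r r' z v
      using that mono[OF that(1)] by (auto split: if_splits)
    show "primrec_fn f g xs = Some v \<longleftrightarrow> (\<exists>r. (if list_encode xs = 0 then 0
        else I r (p2 (list_encode xs - 1)) (p1 (list_encode xs - 1))) = Suc v)" for xs v
      by (cases xs) (auto simp: primrec_fn_def iter)
  qed
  thus ?thesis by blast
qed

lemma approximates_mu:
  assumes F: "approximates F f"
  shows "\<exists>H. approximates H (mu_fn f)"
proof -
  \<comment> \<open>State after testing \<open>0, \<dots>, n - 1\<close>: 0 if all values are positive, 1 if some test was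
    undecided, \<open>m + 2\<close> if \<open>m\<close> is the first zero.\<close>
  define S where "S = (\<lambda>r z. rec_nat 0 (\<lambda>m a. if a \<noteq> 0 then a
      else if F r (Suc (prod_encode (m, z))) = 0 then 1
      else if F r (Suc (prod_encode (m, z))) = 1 then m + 2 else 0))"
  have S_simps: "S r z 0 = 0" "S r z (Suc m) = (if S r z m \<noteq> 0 then S r z m
      else if F r (Suc (prod_encode (m, z))) = 0 then 1
      else if F r (Suc (prod_encode (m, z))) = 1 then m + 2 else 0)" for r z m
    by (simp_all add: S_def)
  let ?c = "\<lambda>m z. Suc (prod_encode (m, z))"
  have S0: "S r z n = 0 \<longleftrightarrow> (\<forall>m<n. F r (?c m z) > 1)" for r z n
    by (induction n) (auto simp: S_simps less_Suc_eq)
  have S2: "S r z n = v + 2 \<longleftrightarrow> v < n \<and> F r (?c v z) = 1 \<and> (\<forall>m<v. F r (?c m z) > 1)" for r z n v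
  proof (induction n)
    case (Suc n)
    show ?case
    proof (cases "S r z n = 0")
      case True
      hence *: "\<forall>m<n. F r (?c m z) > 1" by (simp only: S0)
      show ?thesis using True * by (auto simp: S_simps less_Suc_eq)
    next
      case False
      then obtain m where "m < n" "F r (?c m z) \<le> 1" by (auto simp: S0 not_less)
      with False Suc show ?thesis by (auto simp: S_simps less_Suc_eq dest: leD)
    qed
  qed (simp add: S_simps)
  \<comment> \<open>The stage also bounds the number of tests. Subtracting 1 merges the inconclusive
    states 0 and 1 into "no value yet" and turns \<open>m + 2\<close> into
    \<open>Suc m\<close>.\<close>
  have H: "S r z r - 1 = Suc v \<longleftrightarrow> v < r \<and> F r (?c v z) = 1 \<and> (\<forall>m<v. F r (?c m z) > 1)" for r z v
    using S2[of r z r v] by auto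
  have gt1: "F r' z > 1" if "r \<le> r'" "F r z > 1" for r r' z
    using approximatesD(2)[OF F that(1), of z "F r z - 1"] that(2) by auto
  have "approximates (\<lambda>r z. S r z r - 1) (mu_fn f)"
  proof (rule approximatesI)
    show "total_computable (\<lambda>w. S (p1 w) (p2 w) (p1 w) - 1)"
      unfolding S_def
      by (intro tc_if dec_eq dec_not tc_rec tc_Suc tc_add tc_prod_encode approximatesD(1)[OF F]
          tc_diff tc_p1 tc_p2 tc_const tc_id)
    show "S r' z r' - 1 = Suc v" if le: "r \<le> r'" and *: "S r z r - 1 = Suc v" for r r' z v
    proof -
      have r: "v < r" "F r (?c v z) = 1" "\<forall>m<v. F r (?c m z) > 1"
        using *[unfolded H] by blast+
      moreover have "F r' (?c v z) = 1"
        using approximatesD(2)[OF F le, of _ 0] r(2) by simp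
      ultimately show ?thesis
        unfolding H using gt1[OF le] less_le_trans[OF r(1) le] by blast
    qed
    fix xs v
    let ?z = "list_encode xs"
    have f: "f (m # xs) = Some u \<longleftrightarrow> (\<exists>r. F r (?c m ?z) = Suc u)" for m u
      using approximatesD(3)[OF F, of "m # xs"] by simp
    have uniq: "n = n'" if "first_zero f xs n" "first_zero f xs n'" for n n'
      using that by (cases n n' rule: linorder_cases) (auto simp: first_zero_def)
    have "mu_fn f xs = Some v \<longleftrightarrow> first_zero f xs v"
    proof (cases "\<exists>n. first_zero f xs n")
      case True
      then obtain n where n: "first_zero f xs n" by blast
      hence "(THE n. first_zero f xs n) = n" by (rule the_equality) (rule uniq[OF _ n])
      thus ?thesis using n uniq by (auto simp: mu_fn_def)
    qed (simp add: mu_fn_def)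
    also have "\<dots> \<longleftrightarrow> (\<exists>r. v < r \<and> F r (?c v ?z) = 1 \<and> (\<forall>m<v. F r (?c m ?z) > 1))"
    proof
      assume fz: "first_zero f xs v"
      then obtain r0 where r0: "F r0 (?c v ?z) = 1"
        unfolding first_zero_def f by auto
      have "\<forall>m<v. \<exists>r. F r (?c m ?z) > 1"
      proof safe
        fix m assume "m < v"
        then obtain k r where "F r (?c m ?z) = Suc (Suc k)"
          using fz unfolding first_zero_def f by blast
        thus "\<exists>r. F r (?c m ?z) > 1" by (intro exI[of _ r]) simp
      qed
      then obtain R where R: "\<And>m. m < v \<Longrightarrow> F (R m) (?c m ?z) > 1" by metis
      \<comment> \<open>This stage dominates the finitely many stages at which the values needed
        appear, and exceeds \<open>v\<close> so that the test of \<open>v\<close> is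
        reached.\<close>
      define r where "r = Max (insert (Suc v) (insert r0 (R ` {..<v})))"
      have "r0 \<le> r" "v < r" and Rr: "\<And>m. m < v \<Longrightarrow> R m \<le> r"
        unfolding r_def by (rule Max_ge less_le_trans[OF lessI Max_ge]; auto)+
      moreover have "F r (?c v ?z) = 1"
        using r0 approximatesD(2)[OF F \<open>r0 \<le> r\<close>, of _ 0] by simp
      moreover have "\<forall>m<v. F r (?c m ?z) > 1"
        using gt1[OF Rr R] by blast
      ultimately show "\<exists>r. v < r \<and> F r (?c v ?z) = 1 \<and> (\<forall>m<v. F r (?c m ?z) > 1)"
        by blast
    next
      assume "\<exists>r. v < r \<and> F r (?c v ?z) = 1 \<and> (\<forall>m<v. F r (?c m ?z) > 1)"
      then obtain r where r: "v < r \<and> F r (?c v ?z) = 1 \<and> (\<forall>m<v. F r (?c m ?z) > 1)" ..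
      have "\<exists>k. f (m # xs) = Some (Suc k)" if "m < v" for m
      proof -
        have "F r (?c m ?z) > 1"
          using r that by blast
        then obtain k where "F r (?c m ?z) = Suc (Suc k)"
          by (auto dest: less_imp_Suc_add)
        hence "f (m # xs) = Some (Suc k)" unfolding f by blast
        thus ?thesis by blast
      qed
      moreover have "f (v # xs) = Some 0"
        unfolding f using r by (intro exI[of _ r]) simp
      ultimately show "first_zero f xs v"
        by (simp add: first_zero_def)
    qed
    finally show "mu_fn f xs = Some v \<longleftrightarrow> (\<exists>r. S r ?z r - 1 = Suc v)"
      by (simp only: H)
  qed
  thus ?thesis by blast
qed

lemma partial_recursive_approximates: "partial_recursive f \<Longrightarrow> \<exists>H. approximates H f"
proof (induction rule: partial_recursive.induct)
  case (comp f gs)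
  thus ?case using approximates_comp by blast
qed (use approximates_zero approximates_succ approximates_proj approximates_primrec approximates_mu in blast)+

text \<open>A learner may diverge, so the diagonalization dovetails over stages of this enumeration
  instead of running the learner. \<open>Suc (prod_encode (x, 0))\<close> is the code of
  \<open>[x]\<close>.\<close>

lemma partial_computable_graph:
  assumes "partial_computable f"
  obtains H where "total_computable (\<lambda>w. H (p1 w) (p2 w))"
    "\<And>x v. f x = Some v \<longleftrightarrow> (\<exists>r. H r x = Suc v)"
proof -
  obtain g where g: "partial_recursive g" "\<And>x. g [x] = f x"
    using assms by (auto simp: partial_computable_def)
  obtain K where K: "approximates K g"
    using partial_recursive_approximates[OF g(1)] by blast
  show ?thesis
  proof
    show "total_computable (\<lambda>w. K (p1 w) (Suc (prod_encode (p2 w, 0))))"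
      by (intro approximatesD(1)[OF K] tc_intros)
    show "f x = Some v \<longleftrightarrow> (\<exists>r. K r (Suc (prod_encode (x, 0))) = Suc v)" for x v
      using approximatesD(3)[OF K, of "[x]"] by (simp add: g(2))
  qed
qed

section \<open>The separating class\<close>

definition self_describing :: "(nat \<Rightarrow> nat \<Rightarrow> nat option) \<Rightarrow> (nat \<Rightarrow> nat) \<Rightarrow> nat set set" where
  "self_describing \<phi> t =
     {L \<in> REC. infinite L \<and> finite {x \<in> L. \<not> (C_index \<phi> (t x) \<and> C_set \<phi> (t x) = L)}}"

lemma C_set_in_REC:
  assumes "partial_computable2 \<phi>" "C_index \<phi> e"
  shows "C_set \<phi> e \<in> REC"
proof -
  have "partial_computable (\<lambda>z. \<phi> (p1 z) (p2 z))"
    using assms(1) by (simp add: partial_computable2_iff)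
  from partial_computable_comp[OF this, of "\<lambda>x. prod_encode (e, x)"]
  have "partial_computable (\<phi> e)"
    by (simp add: tc_prod_encode tc_const tc_id)
  moreover have "\<phi> e = (\<lambda>x. Some (if x \<in> C_set \<phi> e then 1 else 0))"
    using assms(2) by (fastforce simp: C_index_def C_set_def)
  ultimately show ?thesis
    by (simp add: REC_def total_computable_def)
qed

lemma characteristic_index:
  assumes "\<And>y. \<phi> e y = Some (if y \<in> L then 1 else 0)"
  shows "C_index \<phi> e" "C_set \<phi> e = L"
  using assms by (auto simp: C_index_def C_set_def)

text \<open>As \<open>L\<close> is infinite, every text eventually shows an element above the
  finitely many exceptions. From then on the maximum of the data is no exception, though it may keep
  growing and the hypotheses with it.\<close>

lemma self_describing_learnable:
  assumes t: "total_computable t"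
  shows "self_describing \<phi> t \<in> Txt_REC Sd (Bc_C \<phi>)"
proof -
  let ?h = "\<lambda>D. Some (t (max_code D))"
  have "partial_computable ?h"
    by (intro pc_Some tc_comp[OF t] tc_max_code)
  moreover have "Txt_learns Sd (Bc_C \<phi>) ?h L" if "L \<in> self_describing \<phi> t" for L
    unfolding Txt_learns_def
  proof (intro allI impI)
    fix T assume "text_for T L"
    hence T: "content T = L" by (simp add: text_for_def)
    let ?good = "\<lambda>x. C_index \<phi> (t x) \<and> C_set \<phi> (t x) = L"
    have L: "infinite L" "finite {x \<in> L. \<not> ?good x}"
      using that by (simp_all add: self_describing_def)
    obtain m where m: "\<And>x. x \<in> L \<Longrightarrow> \<not> ?good x \<Longrightarrow> x \<le> m"
      using L(2) unfolding finite_nat_set_iff_bounded_le by blast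
    obtain y where y: "y \<in> L" "m < y"
      using L(1) unfolding finite_nat_set_iff_bounded_le by (auto simp: not_le)
    then obtain i where i: "T i = Some y"
      using T by (auto simp: content_def image_iff)
    have "\<exists>e. Sd ?h T n = Some e \<and> C_index \<phi> e \<and> C_set \<phi> e = content T" if "Suc i \<le> n" for n
    proof -
      define D where "D = list_content (text_prefix T n)"
      have D: "D = {x. \<exists>k<n. T k = Some x}"
        by (auto simp: D_def list_content_def text_prefix_def)
           (metis atLeast0LessThan imageI lessThan_iff)
      have "D \<subseteq> the ` T ` {..<n}"
        unfolding D by (force simp: image_iff)
      hence fin: "finite D" by (rule finite_subset) auto
      have "y \<in> D" using i that unfolding D by (auto intro: exI[of _ i])
      moreover have "D \<subseteq> L" using T by (auto simp: D content_def) (metis rangeI)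
      ultimately have "Max D \<in> L" "y \<le> Max D"
        using Max_in[OF fin] Max_ge[OF fin] by auto
      hence "?good (Max D)" using m[of "Max D"] y(2) by (meson leD le_trans)
      moreover have "max_code (set_encode D) = Max D"
        using fin \<open>y \<in> D\<close> by (intro max_code_set_encode) auto
      hence "Sd ?h T n = Some (t (Max D))" by (simp add: Sd_def D_def)
      ultimately show ?thesis using T by simp
    qed
    thus "Bc_C \<phi> (Sd ?h T) T" unfolding Bc_C_def by blast
  qed
  ultimately show ?thesis
    by (auto simp: Txt_REC_def self_describing_def)
qed

section \<open>Diagonalization\<close>

text \<open>Histories use the coding of \<open>seq_code\<close>, where 0 is the pause and
  \<open>Suc y\<close> stands for \<open>y\<close>.\<close>

definition entries :: "nat \<Rightarrow> nat set" where
  "entries c = {y. Suc y \<in> set (list_decode c)}"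

lemma finite_entries: "finite (entries c)"
proof -
  have "finite (Suc -` set (list_decode c))" by (intro finite_vimageI) auto
  thus ?thesis by (simp add: entries_def vimage_def)
qed

text \<open>The first component is the program that the index \<open>t x\<close> will run; the
  second names the branch and makes distinct branches disjoint.\<close>

definition member :: "nat \<Rightarrow> nat \<Rightarrow> nat \<Rightarrow> nat" where
  "member e a k = prod_encode (e, prod_encode (a, k))"

text \<open>\<open>p1 (p1 a)\<close> is the history from which branch \<open>a\<close>
  starts.\<close>

definition extend :: "nat \<Rightarrow> nat \<Rightarrow> nat \<Rightarrow> nat" where
  "extend e a k = rec_nat (p1 (p1 a)) (\<lambda>k c. Suc (prod_encode (Suc (member e a k), c))) k"

lemma extend_0: "extend e a 0 = p1 (p1 a)"
  and extend_Suc: "extend e a (Suc k) = Suc (prod_encode (Suc (member e a k), extend e a k))"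
  by (simp_all add: extend_def)

lemma rev_list_decode_extend:
  "rev (list_decode (extend e a k)) = rev (list_decode (p1 (p1 a))) @ map (\<lambda>i. Suc (member e a i)) [0..<k]"
  by (induction k) (simp_all add: extend_0 extend_Suc)

lemma entries_extend: "entries (extend e a k) = member e a ` {..<k} \<union> entries (p1 (p1 a))"
  using arg_cong[OF rev_list_decode_extend, of set e a k] by (auto simp: entries_def)

lemma extend_ge: "p1 (p1 a) + k \<le> extend e a k"
proof (induction k)
  case (Suc k)
  have "extend e a k \<le> prod_encode (Suc (member e a k), extend e a k)" by (rule le_prod_encode_2)
  with Suc show ?case by (simp add: extend_Suc)
qed (simp add: extend_0)

lemma member_eq_iff: "member e a k = member e' a' k' \<longleftrightarrow> e = e' \<and> a = a' \<and> k = k'"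
  by (simp add: member_def prod_encode_eq)

lemma range_member: "y \<in> range (member e a) \<longleftrightarrow> p1 y = e \<and> p1 (p2 y) = a"
proof
  assume "p1 y = e \<and> p1 (p2 y) = a"
  hence "y = member e a (p2 (p2 y))" by (auto simp: member_def)
  thus "y \<in> range (member e a)" by blast
qed (auto simp: member_def)

lemma infinite_range_member: "infinite (range (member e a))"
  using finite_image_iff[of "member e a" UNIV] by (simp add: inj_on_def member_eq_iff)

lemma p1_le: "p1 x \<le> x"
  by (metis le_prod_encode_1 prod.collapse prod_decode_inverse)

text \<open>These bounds make the limit set decidable: a small number can only be a branch element
  with small index, added to a history with small code.\<close>

lemma member_ge: "k \<le> member e a k" "p1 (p1 a) \<le> member e a k"
proof -
  have "prod_encode (a, k) \<le> member e a k" unfolding member_def by (rule le_prod_encode_2)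
  moreover have "a \<le> prod_encode (a, k)" "k \<le> prod_encode (a, k)"
    by (rule le_prod_encode_1, rule le_prod_encode_2)
  ultimately show "k \<le> member e a k" "p1 (p1 a) \<le> member e a k"
    using p1_le[of "p1 a"] p1_le[of a] by linarith+
qed

lemma tc_member: "total_computable e \<Longrightarrow> total_computable a \<Longrightarrow> total_computable k \<Longrightarrow>
    total_computable (\<lambda>z. member (e z) (a z) (k z))"
  unfolding member_def by (intro tc_intros)

lemma tc_extend:
  assumes "total_computable e" "total_computable a" "total_computable k"
  shows "total_computable (\<lambda>z. extend (e z) (a z) (k z))"
  unfolding extend_def
  by (intro tc_rec tc_Suc tc_prod_encode tc_member tc_p1 tc_p2 tc_id assms
      tc_comp[OF assms(1)] tc_comp[OF assms(2)])

section \<open>Texts from coded sequences\<close>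

definition text_of :: "(nat \<Rightarrow> nat) \<Rightarrow> text_fn" where
  "text_of f i = (case f i of 0 \<Rightarrow> None | Suc x \<Rightarrow> Some x)"

lemma content_text_of: "content (text_of f) = {x. Suc x \<in> range f}"
proof -
  have "Some x = text_of f i \<longleftrightarrow> Suc x = f i" for x i
    by (auto simp: text_of_def split: nat.split)
  thus ?thesis by (simp add: content_def image_iff)
qed

lemma G_text_of: "G h (text_of f) n = h (list_encode (map f [0..<n]))"
proof -
  have "case_option 0 Suc (text_of f i) = f i" for i
    by (simp add: text_of_def split: nat.split)
  thus ?thesis by (simp add: G_def seq_code_def text_prefix_def o_def)
qed

text \<open>
  Histories are codes of reversed sequences, so that extending one is a single \<open>Cons\<close>; \<open>H\<close>
  therefore enumerates the graph of \<open>h\<close> composed with reversal.  A state \<open>s\<close> is a pair of a history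
  \<open>p1 s\<close> and a hypothesis \<open>p2 s\<close>, and a branch \<open>a\<close> is a state \<open>p1 a\<close> paired with a label.
\<close>

locale diagonalization =
  fixes H :: "nat \<Rightarrow> nat \<Rightarrow> nat" and h :: learner
  assumes tc_H: "total_computable (\<lambda>w. H (p1 w) (p2 w))"
    and H: "h (list_encode (rev (list_decode c))) = Some v \<longleftrightarrow> (\<exists>r. H r c = Suc v)"
begin

text \<open>A search step \<open>t\<close> codes a prefix length, a label and an enumeration stage of \<open>H\<close>.\<close>

definition val :: "nat \<Rightarrow> nat \<Rightarrow> nat \<Rightarrow> nat" where
  "val e s t = H (p2 (p2 t)) (extend e (prod_encode (s, p1 (p2 t))) (p1 t))"

definition change :: "nat \<Rightarrow> nat \<Rightarrow> nat \<Rightarrow> bool" where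
  "change e s t \<longleftrightarrow> val e s t \<noteq> 0 \<and> val e s t \<noteq> Suc (p2 s)"

text \<open>
  The new history contains all \<open>k \<le> t\<close>, not just the prefix that caused the mind change.  So the
  program of the branch may accept each of its elements with index \<open>k \<le> y\<close> once the search has
  failed up to \<open>y\<close>.
\<close>

definition succ_state :: "nat \<Rightarrow> nat \<Rightarrow> nat \<Rightarrow> nat" where
  "succ_state e s t = prod_encode (extend e (prod_encode (s, p1 (p2 t))) (Suc t), val e s t - 1)"

definition next_state :: "nat \<Rightarrow> nat \<Rightarrow> nat option" where
  "next_state e s = Option.bind (if \<exists>t. change e s t then Some (LEAST t. change e s t) else None)
     (\<lambda>t. Some (succ_state e s t))"

definition run :: "nat \<Rightarrow> nat \<Rightarrow> nat \<Rightarrow> nat option" where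
  "run e s n = rec_nat (Some s) (\<lambda>k r. Option.bind r (next_state e)) n"

text \<open>For \<open>x = member e a k\<close>, \<open>p1 x\<close> is \<open>e\<close> and
  \<open>p1 (p1 (p2 x))\<close> is the state at which branch \<open>a\<close> starts. While the
  search has not succeeded up to \<open>y\<close>, this state and the whole branch are accepted.
  Otherwise the construction is run for \<open>Suc y\<close> further stages, enough in the actual
  run to make all elements added later exceed \<open>y\<close>.\<close>

definition decide :: "nat \<Rightarrow> nat \<Rightarrow> nat option" where
  "decide x y = Option.bind
     (run (p1 x) (p1 (p1 (p2 x))) (if \<exists>t\<le>y. change (p1 x) (p1 (p1 (p2 x))) t then Suc y else 0))
     (\<lambda>s. Some (if Suc y \<in> set (list_decode (p1 s)) \<or>
        \<not> (\<exists>t\<le>y. change (p1 x) (p1 (p1 (p2 x))) t) \<and> p1 y = p1 x \<and> p1 (p2 y) = p1 (p2 x) then 1 else 0))"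

section \<open>Computability of the construction\<close>

lemma tc_val:
  assumes "total_computable e" "total_computable s" "total_computable t"
  shows "total_computable (\<lambda>z. val (e z) (s z) (t z))"
proof -
  have "total_computable (\<lambda>z. H (p1 (prod_encode (a z, b z))) (p2 (prod_encode (a z, b z))))"
    if "total_computable a" "total_computable b" for a b
    by (intro tc_comp[OF tc_H] tc_prod_encode that)
  hence *: "total_computable (\<lambda>z. H (a z) (b z))" if "total_computable a" "total_computable b" for a b
    using that by simp
  show ?thesis
    unfolding val_def by (intro * tc_extend tc_prod_encode tc_p1 tc_p2 assms)
qed

lemma dec_change:
  "total_computable e \<Longrightarrow> total_computable s \<Longrightarrow> total_computable t \<Longrightarrow>
    decidable (\<lambda>z. change (e z) (s z) (t z))"
  unfolding change_def by (intro dec_conj dec_not dec_eq tc_val tc_intros)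

lemma tc_succ_state:
  "total_computable e \<Longrightarrow> total_computable s \<Longrightarrow> total_computable t \<Longrightarrow>
    total_computable (\<lambda>z. succ_state (e z) (s z) (t z))"
  unfolding succ_state_def by (intro tc_prod_encode tc_diff tc_extend tc_val tc_Suc tc_p1 tc_p2 tc_const)

lemma pc_next_state:
  assumes "total_computable e" "total_computable s"
  shows "partial_computable (\<lambda>z. next_state (e z) (s z))"
  unfolding next_state_def
  by (intro pc_bind pc_mu pc_Some dec_change tc_succ_state tc_p2 tc_id
      tc_comp[OF assms(1)] tc_comp[OF assms(2)] tc_p1)

lemma pc_run:
  assumes "total_computable e" "total_computable s" "total_computable n"
  shows "partial_computable (\<lambda>z. run (e z) (s z) (n z))"
  unfolding run_def
  by (intro pc_iter pc_Some pc_next_state assms tc_comp[OF assms(1)] tc_p1 tc_p2 tc_id)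

lemma pc_decide: "partial_computable (\<lambda>z. decide (p1 z) (p2 z))"
  unfolding decide_def
  by (intro pc_bind pc_run tc_if dec_bex dec_change pc_Some dec_disj dec_conj dec_not dec_eq dec_mem
      tc_Suc tc_p1 tc_p2 tc_const tc_id)

lemma run_0: "run e s 0 = Some s"
  and run_Suc: "run e s (Suc n) = Option.bind (run e s n) (next_state e)"
  by (simp_all add: run_def)

lemma decide_member:
  "decide (member e a k) y = Option.bind (run e (p1 a) (if \<exists>t\<le>y. change e (p1 a) t then Suc y else 0))
     (\<lambda>s. Some (if y \<in> entries (p1 s) \<or> \<not> (\<exists>t\<le>y. change e (p1 a) t) \<and> y \<in> range (member e a) then 1 else 0))"
  by (simp only: decide_def range_member entries_def mem_Collect_eq) (simp add: member_def)

text \<open>On the history followed by branch \<open>b\<close>, \<open>h\<close> converges to a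
  correct hypothesis; if it differed from \<open>p2 s\<close>, the search would find it. The left
  side does not depend on \<open>b\<close>, which yields the contradiction in
  \<open>not_stuck\<close>.\<close>

lemma stuck_hypothesis:
  assumes \<phi>: "partial_computable2 \<phi>" and t: "\<And>a k. \<phi> (t (member e a k)) = decide (member e a k)"
    and h: "\<And>L. L \<in> self_describing \<phi> t \<Longrightarrow> Txt_learns G (Ex_C \<phi>) h L"
    and stuck: "\<And>t. \<not> change e s t"
  shows "C_set \<phi> (p2 s) = entries (p1 s) \<union> range (member e (prod_encode (s, b)))"
proof -
  define a where "a = prod_encode (s, b)"
  define L where "L = entries (p1 s) \<union> range (member e a)"
  have p1_a: "p1 a = s" by (simp add: a_def)
  \<comment> \<open>The search fails for every bound, so the program never leaves the state
    \<open>s\<close> and decides exactly \<open>L\<close>.\<close>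
  have dec: "\<phi> (t (member e a k)) y = Some (if y \<in> L then 1 else 0)" for k y
    by (simp add: t decide_member p1_a stuck run_0 L_def)
  note good = characteristic_index[of \<phi>, OF dec]
  have "{x \<in> L. \<not> (C_index \<phi> (t x) \<and> C_set \<phi> (t x) = L)} \<subseteq> entries (p1 s)"
    using good by (auto simp: L_def)
  moreover have "L \<in> REC"
    using C_set_in_REC[OF \<phi> good(1)] good(2) by simp
  moreover have "infinite L"
    using infinite_range_member by (simp add: L_def)
  ultimately have "L \<in> self_describing \<phi> t"
    using finite_subset[OF _ finite_entries[of "p1 s"]] by (simp add: self_describing_def)
  hence "Txt_learns G (Ex_C \<phi>) h L" by (rule h)
  define l where "l = rev (list_decode (p1 s))"
  define f where "f i = (if i < length l then l ! i else Suc (member e a (i - length l)))" for i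
  have "range f = set l \<union> Suc ` range (member e a)"
  proof -
    have "f ` {..<length l} = set l"
      by (auto simp: f_def in_set_conv_nth image_iff)
    moreover have "f ` {length l..} = Suc ` range (member e a)"
    proof -
      have "{length l..} = range (\<lambda>k. length l + k)"
        by (auto simp: image_iff le_iff_add)
      moreover have "f (length l + k) = Suc (member e a k)" for k
        by (simp add: f_def)
      ultimately show ?thesis by (simp only: image_image)
    qed
    moreover have "range f = f ` {..<length l} \<union> f ` {length l..}"
      unfolding image_Un[symmetric] by (rule arg_cong) auto
    ultimately show ?thesis by simp
  qed
  hence "content (text_of f) = L"
    by (auto simp: content_text_of L_def entries_def l_def)
  with \<open>Txt_learns G (Ex_C \<phi>) h L\<close> have "Ex_C \<phi> (G h (text_of f)) (text_of f)"
    by (simp add: Txt_learns_def text_for_def)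
  then obtain n0 w where n0: "\<And>n. n0 \<le> n \<Longrightarrow> G h (text_of f) n = Some w" and w: "C_set \<phi> w = L"
    using \<open>content (text_of f) = L\<close> unfolding Ex_C_def by metis
  have "map f [0..<length l + n0] = rev (list_decode (extend e a n0))"
    unfolding rev_list_decode_extend p1_a l_def[symmetric]
    by (intro nth_equalityI) (auto simp: f_def nth_append)
  hence "h (list_encode (rev (list_decode (extend e a n0)))) = Some w"
    using n0[of "length l + n0"] by (simp add: G_text_of)
  then obtain r where "H r (extend e a n0) = Suc w"
    by (auto simp: H)
  \<comment> \<open>The output \<open>w\<close> is seen at the search step for prefix length
    \<open>n0\<close>, label \<open>b\<close> and stage \<open>r\<close>.\<close>
  hence "val e s (prod_encode (n0, prod_encode (b, r))) = Suc w"
    by (simp add: val_def a_def)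
  hence "w = p2 s"
    using stuck[of "prod_encode (n0, prod_encode (b, r))"] by (simp add: change_def)
  with w show ?thesis by (simp add: L_def a_def)
qed

text \<open>Labels 0 and 1 would give the same set, so the infinite branch 0, being disjoint from
  branch 1, would lie in the finite history.\<close>

lemma not_stuck:
  assumes "partial_computable2 \<phi>" "\<And>a k. \<phi> (t (member e a k)) = decide (member e a k)"
    "\<And>L. L \<in> self_describing \<phi> t \<Longrightarrow> Txt_learns G (Ex_C \<phi>) h L"
  shows "\<exists>t. change e s t"
proof (rule ccontr)
  assume "\<nexists>t. change e s t"
  hence "\<not> change e s t" for t by blast
  note C = stuck_hypothesis[OF assms this]
  have "range (member e (prod_encode (s, 0))) \<subseteq> entries (p1 s)"
    using C[of 0] C[of 1] by (auto simp: member_eq_iff prod_encode_eq)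
  thus False
    using finite_entries infinite_range_member finite_subset by blast
qed

section \<open>The limit set and its text when all stages end\<close>

lemma not_all_learned:
  assumes \<phi>: "partial_computable2 \<phi>" and t: "\<And>a k. \<phi> (t (member e a k)) = decide (member e a k)"
    and h: "\<And>L. L \<in> self_describing \<phi> t \<Longrightarrow> Txt_learns G (Ex_C \<phi>) h L"
  shows False
proof -
  define \<tau> where "\<tau> s = (LEAST t. change e s t)" for s
  \<comment> \<open>State 0 is the empty history with hypothesis 0, which need not be an output of
    \<open>h\<close>.\<close>
  define S where "S n = rec_nat 0 (\<lambda>n s. succ_state e s (\<tau> s)) n" for n :: nat
  define T where "T n = \<tau> (S n)" for n
  define R where "R n = p1 (S n)" for n
  \<comment> \<open>The label in the successful search step selects the branch that is kept.\<close>
  define a where "a n = prod_encode (S n, p1 (p2 (T n)))" for n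
  have S_Suc: "S (Suc n) = succ_state e (S n) (T n)" for n
    by (simp add: S_def T_def)
  have change: "change e (S n) (T n)" for n
    unfolding T_def \<tau>_def using not_stuck[OF \<phi> t h] by (rule LeastI_ex)
  have no_change: "\<not> change e (S n) u" if "u < T n" for n u
    using that unfolding T_def \<tau>_def by (rule not_less_Least)
  have next_S: "next_state e (S n) = Some (S (Suc n))" for n
    using not_stuck[OF \<phi> t h, of "S n"] by (simp add: next_state_def S_Suc T_def \<tau>_def)
  have run_S: "run e (S n) m = Some (S (n + m))" for n m
    by (induction m) (simp_all add: run_0 run_Suc next_S)
  have R_Suc: "R (Suc n) = extend e (a n) (Suc (T n))" for n
    by (simp add: R_def S_Suc succ_state_def a_def)
  have p1_a: "p1 (a n) = S n" for n by (simp add: a_def)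
  have p1_p1_a: "p1 (p1 (a n)) = R n" for n by (simp add: p1_a R_def)
  have R_less: "R n < R (Suc n)" "T n < R (Suc n)" for n
    using extend_ge[of "a n" "Suc (T n)" e] by (simp_all add: R_Suc p1_p1_a)
  have R_mono: "R n \<le> R m" if "n \<le> m" for n m
    by (rule lift_Suc_mono_le[of R, OF less_imp_le[OF R_less(1)] that])
  have R_ge: "n \<le> R n" for n
  proof (induction n)
    case (Suc n)
    thus ?case using R_less(1)[of n] by linarith
  qed simp
  have entries_Suc: "entries (R (Suc n)) = member e (a n) ` {..T n} \<union> entries (R n)" for n
    by (simp add: R_Suc entries_extend p1_p1_a lessThan_Suc_atMost)
  define L where "L = (\<Union>n. entries (R n))"
  have entries_mono: "entries (R n) \<subseteq> entries (R m)" if "n \<le> m" for n m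
    by (rule lift_Suc_mono_le[of "\<lambda>n. entries (R n)", OF _ that]) (simp add: entries_Suc)
  have late: "y \<in> entries (R n) \<or> (\<exists>m\<ge>n. \<exists>k. y = member e (a m) k \<and> k \<le> T m)" if y: "y \<in> L" for y n
  proof -
    obtain m where "y \<in> entries (R m)" using y by (auto simp: L_def)
    thus ?thesis
    proof (induction m)
      case 0
      thus ?case using entries_mono[of 0 n] by auto
    next
      case (Suc m)
      show ?case
      proof (cases "n \<le> m")
        case True
        with Suc show ?thesis unfolding entries_Suc by blast
      next
        case False
        with Suc.prems show ?thesis using entries_mono[of "Suc m" n] by auto
      qed
    qed
  qed
  have member_gt: "R m \<le> member e (a m) k" for m k
    using member_ge(2)[of "a m" e k] by (simp add: p1_p1_a)
  have dec: "\<phi> (t (member e (a n) k)) y = Some (if y \<in> L then 1 else 0)" for n k y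
  proof (cases "\<exists>u\<le>y. change e (S n) u")
    \<comment> \<open>The program inspects the history of stage \<open>n + Suc y\<close>. Elements
      added from there on are at least \<open>R m\<close> with \<open>m > y\<close>, so they exceed
      \<open>y\<close>.\<close>
    case True
    have "y \<in> entries (R (Suc (n + y)))" if "y \<in> L"
    proof -
      have "y \<noteq> member e (a m) k" if "Suc (n + y) \<le> m" for m k
        using that member_gt[of m k] R_ge[of m] by linarith
      thus ?thesis using late[OF that, of "Suc (n + y)"] by blast
    qed
    hence "y \<in> entries (R (Suc (n + y))) \<longleftrightarrow> y \<in> L"
      by (auto simp: L_def)
    thus ?thesis
      unfolding t decide_member p1_a using True by (simp add: run_S R_def[symmetric])
  next
    case False
    \<comment> \<open>Now \<open>y\<close> lies below \<open>T n\<close>, hence below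
      \<open>R (Suc n)\<close>, so no branch after \<open>a n\<close> contains
      \<open>y\<close>.\<close>
    hence y: "y < T n" using change[of n] by (meson not_less)
    have "y \<in> entries (R n) \<or> y \<in> range (member e (a n))" if "y \<in> L"
    proof -
      have "y < member e (a m) k" if "m > n" for m k
        using member_gt[of m k] R_mono[of "Suc n" m] R_less(2)[of n] y that by simp
      thus ?thesis using late[OF that, of n] by (metis le_neq_implies_less less_irrefl rangeI)
    qed
    moreover have "y \<in> L" if "y = member e (a n) k" for k
    proof -
      \<comment> \<open>An element is at least its index, so an accepted \<open>y\<close> has index
        below \<open>T n\<close> and is among the elements that the next history retains.\<close>
      have "k \<le> T n" using member_ge(1)[of k e "a n"] y that by simp
      hence "y \<in> entries (R (Suc n))" using that by (simp add: entries_Suc)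
      thus ?thesis by (auto simp: L_def)
    qed
    ultimately have "y \<in> entries (R n) \<or> y \<in> range (member e (a n)) \<longleftrightarrow> y \<in> L"
      by (auto simp: L_def)
    thus ?thesis
      unfolding t decide_member p1_a if_not_P[OF False] run_0 using False by (simp add: R_def)
  qed
  note good = characteristic_index[of \<phi>, OF dec]
  have "entries (R 0) = {}"
  proof -
    have "prod_decode 0 = (0, 0)" by (simp add: prod_decode_def prod_decode_aux.simps)
    thus ?thesis by (simp add: R_def S_def entries_def)
  qed
  \<comment> \<open>With an empty initial history, every element of \<open>L\<close> comes from a
    chosen branch, so there are no exceptions at all.\<close>
  hence L_member: "\<exists>n k. x = member e (a n) k" if "x \<in> L" for x
    using late[OF that, of 0] by blast
  have "C_index \<phi> (t x) \<and> C_set \<phi> (t x) = L" if "x \<in> L" for x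
    using L_member[OF that] good by blast
  hence "{x \<in> L. \<not> (C_index \<phi> (t x) \<and> C_set \<phi> (t x) = L)} \<subseteq> {}"
    by blast
  hence "finite {x \<in> L. \<not> (C_index \<phi> (t x) \<and> C_set \<phi> (t x) = L)}"
    by (rule finite_subset) simp
  moreover have "L \<in> REC"
    using C_set_in_REC[OF \<phi> good(1)] good(2) by simp
  moreover have "infinite L"
  proof
    assume "finite L"
    then obtain n where n: "\<And>x. x \<in> L \<Longrightarrow> x < n"
      unfolding finite_nat_set_iff_bounded by blast
    have "member e (a n) 0 \<in> entries (R (Suc n))" by (simp add: entries_Suc)
    moreover have "n \<le> member e (a n) 0" using member_gt[of n 0] R_ge[of n] by linarith
    ultimately show False using n[of "member e (a n) 0"] by (auto simp: L_def)
  qed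
  ultimately have "L \<in> self_describing \<phi> t"
    unfolding self_describing_def by blast
  hence "Txt_learns G (Ex_C \<phi>) h L" by (rule h)
  define l where "l n = rev (list_decode (R n))" for n
  have l_extend: "rev (list_decode (extend e (a n) k)) = l n @ map (\<lambda>i. Suc (member e (a n) i)) [0..<k]" for n k
    by (simp add: rev_list_decode_extend p1_p1_a l_def)
  have l_Suc: "l (Suc n) = l n @ map (\<lambda>i. Suc (member e (a n) i)) [0..<Suc (T n)]" for n
    using l_extend[of n "Suc (T n)"] by (simp add: l_def R_Suc)
  have l_len: "n \<le> length (l n)" for n
    by (induction n) (auto simp: l_Suc)
  have l_prefix: "\<exists>xs. l m = l n @ xs" if "n \<le> m" for n m
    using that by (induction m rule: dec_induct) (auto simp: l_Suc)
  \<comment> \<open>Position \<open>i\<close> exists in \<open>l (Suc i)\<close>, as each stage adds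
    at least one element.\<close>
  define f where "f i = l (Suc i) ! i" for i
  have f: "f i = l n ! i" if "i < length (l n)" for i n
  proof -
    have "i < length (l (Suc i))" using l_len[of "Suc i"] by simp
    thus ?thesis
      using that l_prefix[of n "Suc i"] l_prefix[of "Suc i" n]
      by (cases "n \<le> Suc i") (auto simp: f_def nth_append)
  qed
  \<comment> \<open>The next history keeps \<open>Suc (T n)\<close> elements of the branch, so the
    shorter prefix on which the mind change was found is a prefix of the text.\<close>
  have map_f: "map f [0..<length (l n) + k] = rev (list_decode (extend e (a n) k))" if "k \<le> T n" for n k
    unfolding l_extend using that
    by (intro nth_equalityI) (auto simp: f[of _ "Suc n"] l_Suc nth_append simp del: upt_Suc)
  have "content (text_of f) = L"
  proof -
    have "Suc x \<in> range f \<longleftrightarrow> (\<exists>n. Suc x \<in> set (l n))" for x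
    proof
      assume "Suc x \<in> range f"
      then obtain i where "Suc x = l (Suc i) ! i" by (auto simp: f_def)
      thus "\<exists>n. Suc x \<in> set (l n)" using l_len[of "Suc i"] by (metis Suc_le_lessD nth_mem)
    next
      assume "\<exists>n. Suc x \<in> set (l n)"
      then obtain n i where "i < length (l n)" "Suc x = l n ! i" by (metis in_set_conv_nth)
      thus "Suc x \<in> range f" using f by (metis rangeI)
    qed
    thus ?thesis by (auto simp: content_text_of L_def entries_def l_def)
  qed
  with \<open>Txt_learns G (Ex_C \<phi>) h L\<close> have "Ex_C \<phi> (G h (text_of f)) (text_of f)"
    by (simp add: Txt_learns_def text_for_def)
  then obtain n0 w where n0: "\<And>n. n0 \<le> n \<Longrightarrow> G h (text_of f) n = Some w"
    unfolding Ex_C_def by metis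
  \<comment> \<open>The hypothesis stored by a stage is an output of \<open>h\<close> on this text,
    hence \<open>w\<close> late in the text, but it differs from the one stored before. Two
    consecutive stages then contradict each other.\<close>
  have "p2 (S (Suc n)) = w \<and> p2 (S (Suc n)) \<noteq> p2 (S n)" if "n0 \<le> n" for n
  proof -
    let ?j = "p1 (T n)"
    have "?j \<le> T n" by (rule p1_le)
    have v: "val e (S n) (T n) = Suc (p2 (S (Suc n)))"
      using change[of n] by (simp add: change_def S_Suc succ_state_def)
    hence "H (p2 (p2 (T n))) (extend e (a n) ?j) = Suc (p2 (S (Suc n)))"
      by (simp add: val_def a_def)
    hence "h (list_encode (rev (list_decode (extend e (a n) ?j)))) = Some (p2 (S (Suc n)))"
      by (auto simp: H)
    hence "G h (text_of f) (length (l n) + ?j) = Some (p2 (S (Suc n)))"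
      by (simp add: G_text_of map_f[OF \<open>?j \<le> T n\<close>])
    moreover have "n0 \<le> length (l n) + ?j" using l_len[of n] that by simp
    ultimately show ?thesis
      using n0 change[of n] v by (simp add: change_def)
  qed
  from this[of n0] this[of "Suc n0"] show False by simp
qed

end

theorem theorem15:
  fixes \<phi> :: "nat \<Rightarrow> nat \<Rightarrow> nat option"
  assumes "acceptable_numbering \<phi>"
  shows "Txt_REC Sd (Bc_C \<phi>) - Txt_REC G (Ex_C \<phi>) \<noteq> {}"
proof -
  have \<phi>: "partial_computable2 \<phi>"
    using assms by (simp add: acceptable_numbering_def)
  have translate: "\<exists>t. total_computable t \<and> (\<forall>e. \<phi> (t e) = \<psi> e)"
    if "partial_computable (\<lambda>z. \<psi> (p1 z) (p2 z))" for \<psi>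
    using assms that by (simp add: acceptable_numbering_def partial_computable2_iff)
  \<comment> \<open>The program \<open>p1 x\<close> is run on the pair of \<open>x\<close> and
    \<open>y\<close>, so it can read its own code in \<open>x\<close>.\<close>
  have "partial_computable (\<lambda>z. \<phi> (p1 (prod_encode (p1 (p1 z), z))) (p2 (prod_encode (p1 (p1 z), z))))"
    using \<phi> unfolding partial_computable2_iff
    by (rule partial_computable_comp) (intro tc_intros)
  hence "partial_computable (\<lambda>z. \<phi> (p1 (p1 z)) (prod_encode (p1 z, p2 z)))"
    by simp
  from translate[of "\<lambda>x y. \<phi> (p1 x) (prod_encode (x, y))", OF this]
  obtain t where t: "total_computable t" "\<And>x. \<phi> (t x) = (\<lambda>y. \<phi> (p1 x) (prod_encode (x, y)))"
    by blast
  have "self_describing \<phi> t \<notin> Txt_REC G (Ex_C \<phi>)"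
  proof
    assume "self_describing \<phi> t \<in> Txt_REC G (Ex_C \<phi>)"
    then obtain h where h: "partial_computable h"
      "\<And>L. L \<in> self_describing \<phi> t \<Longrightarrow> Txt_learns G (Ex_C \<phi>) h L"
      by (auto simp: Txt_REC_def)
    have "partial_computable (\<lambda>c. h (list_encode (rev (list_decode c))))"
      by (intro partial_computable_comp[OF h(1)] tc_list_encode_rev tc_id)
    then obtain H where "total_computable (\<lambda>w. H (p1 w) (p2 w))"
      "\<And>c v. h (list_encode (rev (list_decode c))) = Some v \<longleftrightarrow> (\<exists>r. H r c = Suc v)"
      by (rule partial_computable_graph) blast
    then interpret diagonalization H h by unfold_locales
    have "partial_computable (\<lambda>z. decide (p1 (p2 z)) (p2 (p2 z)))"
      by (rule partial_computable_comp[OF pc_decide]) (intro tc_intros)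
    \<comment> \<open>A numbering constant in its first argument yields an index of
      \<open>decide\<close>. Since \<open>decide\<close> receives \<open>e\<close> only through its
      input, \<open>e\<close> can be chosen without circularity.\<close>
    from translate[of "\<lambda>_ z. decide (p1 z) (p2 z)", OF this]
    obtain e where e: "\<phi> e = (\<lambda>z. decide (p1 z) (p2 z))" by blast
    have "\<phi> (t (member e a k)) = decide (member e a k)" for a k
      by (simp add: t(2)) (simp add: member_def e)
    from not_all_learned[OF \<phi> this h(2)] show False .
  qed
  with self_describing_learnable[OF t(1)] show ?thesis by blast
qed

end
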